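(* Assume $R_0=+\infty$, let $\ell$, $K$, $L$, $\mu$, $\varphi_a$ and $A$ be as described in the context (with $R_0=+\infty$), and let $\eta,\delta\in(0,1)$ and $C_0>0$. There exist constants $a>2$ and $\theta\in(0,1)$ such that, with $\varphi=\varphi_a$, the following holds. If for $r>0$ and $v\in C_b^2(\mathbb{R}^d)$ the conditions \begin{align*} -Av(x)&\le L(\varphi(r))\ (=a^{-1}L(r)) &&\text{for } x\in B_{\varphi(r)},\\ v(x)&\le 1 &&\text{for } x\in B_{\varphi(r)},\\ v(x)&\le C_0\left(\frac{L(\varphi(r))}{L(|x|)}\right)^{\eta} &&\text{for } x\in\mathbb{R}^d\setminus B_{\varphi(r)},\\ \mu\big((B_{\varphi(r)}\setminus B_r)\cap\{v\le 0\}\big)&\ge \delta\,\mu\big(B_{\varphi(r)}\setminus B_r\big) \end{align*} are satisfied, then $$v(x)\le 1-\theta\quad\text{for all } x\in B_r.$$ (The constants $a$ and $\theta$ do not depend on $r$ or $v$.)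
   Context: $B_s$ denotes the open ball in $\mathbb{R}^d$ of radius $s$ centered at $0$. $C_b^2(\mathbb{R}^d)$ is the set of functions $\mathbb{R}^d\to\mathbb{R}$ which, together with their first and second derivatives, are continuous and bounded. Here $R_0=+\infty$. Fixed constants: $\kappa\ge1$, $K_0\ge 1$, $c_L\in(0,1)$, $c_U\ge1$, $\gamma\in(0,2)$. The function $\ell:(0,\infty)\to(0,\infty)$ satisfies $\int_0^{\infty}\ell(s)\frac{ds}{s}=+\infty$ and - $\int_r^{\infty}\ell(s)\frac{ds}{s}<+\infty$ for all $r>0$; - $\frac{\ell(r\lambda)}{\ell(r)}\ge c_L\lambda^{-\gamma}$ for all $r>0$, $\lambda\ge1$; - $\frac{\ell(r\lambda)}{\ell(r)}\le c_U\lambda^{d}$ for all $r>0$, $\lambda\ge1$. The kernel $K:\mathbb{R}^d\times(\mathbb{R}^d\setminus\{0\})\to[0,+\infty)$ is measurable, $K(x,h)=K(x,-h)$ for all $x,h$, and - $\kappa^{-1}|h|^{-d}\ell(|h|)\le K(x,h)\le\kappa|h|^{-d}\ell(|h|)$ for all $x\in\mathbb{R}^d$ and $h\neq0$; - $\sup_{x\in\mathbb{R}^d}\int_{\mathbb{R}^d\setminus\{0\}}(1\wedge|h|^2)K(x,h)\,dh\le K_0$. The operator $A$ is defined for $u\in C_b^2(\mathbb{R}^d)$ by $$Au(x)=\int_{\mathbb{R}^d\setminus\{0\}}\big(u(x+h)-u(x)-\langle\nabla u(x),h\rangle\mathbf{1}_{B_1}(h)\big)K(x,h)\,dh.$$ $L:(0,\infty)\to(0,\infty)$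 is $L(r)=\int_r^{\infty}\frac{\ell(s)}{s}\,ds$; it is strictly decreasing with $L(0+)=+\infty$ and limit $0$ at $+\infty$, and $L^{-1}$ is its inverse. The measure $\mu$ on Borel sets of $\mathbb{R}^d$ is $\mu(dy)=\frac{\ell(|y|)}{L(|y|)}\frac{dy}{|y|^d}$. For $a>1$, $\varphi_a:(0,\infty)\to(0,\infty)$ is $\varphi_a(r)=L^{-1}(a^{-1}L(r))$. *)

theory Defs
  imports "HOL-Analysis.Analysis"
begin

definition Cb2 :: "('a::euclidean_space \<Rightarrow> real) set" where
  "Cb2 = {u. continuous_on UNIV u \<and> bounded (range u) \<and>
     (\<exists>(G :: 'a \<Rightarrow> 'a) (H :: 'a \<Rightarrow> 'a \<Rightarrow>\<^sub>L 'a).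
        (\<forall>x. GDERIV u x :> G x) \<and> continuous_on UNIV G \<and> bounded (range G) \<and>
        (\<forall>x. (G has_derivative blinfun_apply (H x)) (at x)) \<and>
        continuous_on UNIV H \<and> bounded (range H))}"

definition grad :: "('a::euclidean_space \<Rightarrow> real) \<Rightarrow> 'a \<Rightarrow> 'a" where
  "grad u x = (THE D. GDERIV u x :> D)"

text \<open>The Bochner integral is 0 for non-integrable integrands; for \<open>u \<in> Cb2\<close> and a kernel
  with \<open>\<integral> (1 \<and> |h|\<^sup>2) K(x,h) dh < \<infinity>\<close> the integrand below is absolutely integrable.\<close>

definition nonlocal_op ::
    "('a::euclidean_space \<Rightarrow> 'a \<Rightarrow> real) \<Rightarrow> ('a \<Rightarrow> real) \<Rightarrow> 'a \<Rightarrow> real" where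
  "nonlocal_op K u x =
     (LINT h:-{0}|lborel.
        (u (x + h) - u x - inner (grad u x) h * indicator (ball 0 1) h) * K x h)"

definition L_fun :: "(real \<Rightarrow> real) \<Rightarrow> real \<Rightarrow> real" where
  "L_fun l r = (LINT s:{r<..}|lborel. l s / s)"

definition L_inv :: "(real \<Rightarrow> real) \<Rightarrow> real \<Rightarrow> real" where
  "L_inv l = the_inv_into {0<..} (L_fun l)"

definition phi :: "(real \<Rightarrow> real) \<Rightarrow> real \<Rightarrow> real \<Rightarrow> real" where
  "phi l a r = L_inv l (L_fun l r / a)"

text \<open>The value of the density at the origin is irrelevant, as \<open>{0}\<close> is a null set.\<close>

definition mu :: "(real \<Rightarrow> real) \<Rightarrow> 'a::euclidean_space measure" where
  "mu l = density lborel
     (\<lambda>y. ennreal (l (norm y) / L_fun l (norm y) / norm y ^ DIM('a)))"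

end

theory Submission
  imports Defs
begin

text \<open>If \<open>v > 1 - \<theta>\<close> somewhere in \<open>B\<^sub>r\<close>, then \<open>w = v + \<theta> (2 - |x|\<^sup>2 / (2 r\<^sup>2))\<close> exceeds 1 there, while
  \<open>w \<le> 1\<close> on \<open>B\<^sub>\<rho>\<close> outside \<open>B\<^sub>2\<^sub>r\<close>, where \<open>\<rho> = \<phi>\<^sub>a(r)\<close>. At a maximum point \<open>x\<close> of \<open>w\<close> over \<open>B\<^sub>2\<^sub>r\<close>
  we bound \<open>Av(x)\<close> from above, writing it as an integral of symmetric second differences, which
  eliminates the gradient. The quadratic costs \<open>O(\<theta> L(r)) = O(\<theta> a L(\<rho>))\<close>, the growth of \<open>v\<close> outside
  \<open>B\<^sub>\<rho>\<close> costs \<open>O(L(\<rho>))\<close>, and the set \<open>{v \<le> 0}\<close> in the annulus gains a multiple of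
  \<open>L(\<rho>) \<mu>(B\<^sub>\<rho> - B\<^sub>r)\<close>, i.e. of \<open>L(\<rho>) ln a\<close>. Taking first \<open>a\<close> large and then \<open>\<theta>\<close> small of order \<open>1 / a\<close>
  contradicts \<open>-Av(x) \<le> L(\<rho>)\<close>. The latter two are computed from the fact that
  \<open>y \<mapsto> L(|y|)\<close> maps \<open>\<ell>(|y|) |y|\<^sup>-\<^sup>d dy\<close> to a multiple of Lebesgue measure on \<open>(0, \<infinity>)\<close>.\<close>

subsection \<open>Polar coordinates\<close>

text \<open>The half-lines \<open>{..<x}\<close> are stable under intersection and generate the
  Borel sets, and finitely measured ones exhaust the line, so they determine the image measure.
  Polar coordinates and the substitution \<open>t = L s\<close> thus both reduce to measuring
  sublevel sets of \<open>T\<close>.\<close>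

lemma nn_integral_distr_eqI:
  fixes T :: "'b \<Rightarrow> real"
  assumes T: "T \<in> borel_measurable M" and N: "sets N = sets borel"
    and eq: "\<And>x. emeasure M {y \<in> space M. T y < x} = emeasure N {..<x}"
    and fin: "\<And>x. emeasure N {..<x} < \<infinity>"
    and f: "f \<in> borel_measurable borel"
  shows "(\<integral>\<^sup>+y. f (T y) \<partial>M) = (\<integral>\<^sup>+t. f t \<partial>N)"
proof -
  have "emeasure (distr M borel T) {..<x} = emeasure N {..<x}" for x
    using T by (subst emeasure_distr) (auto simp: eq[symmetric] vimage_def Int_def conj_commute)
  moreover have "(\<Union>i::nat. {..<real i}) = UNIV"
    using reals_Archimedean2 by auto
  moreover have "Int_stable (range (lessThan :: real \<Rightarrow> real set))"
  proof -
    have "{..<a} \<inter> {..<b} = {..<min a b}" for a b :: real by auto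
    then show ?thesis unfolding Int_stable_def by blast
  qed
  ultimately have "distr M borel T = N"
    using fin N by (intro measure_eqI_generator_eq[where E="range lessThan" and \<Omega>=UNIV
          and A="\<lambda>i. {..<real i}"]) (auto simp: borel_Iio less_top[symmetric])
  then show ?thesis
    using nn_integral_distr[OF T] f by force
qed

text \<open>The sublevel sets of the norm are balls, with volume
  \<open>unit_ball_vol D * x ^ D\<close>. The derivative of this in \<open>x\<close> is the density
  of \<open>N\<close>, so \<open>N\<close> is the image of Lebesgue measure under the norm.\<close>

lemma nn_integral_norm:
  fixes f :: "real \<Rightarrow> ennreal"
  assumes f: "f \<in> borel_measurable borel"
  defines "D \<equiv> DIM('a::euclidean_space)"
  shows "(\<integral>\<^sup>+y. f (norm (y::'a)) \<partial>lborel) =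
    ennreal (D * unit_ball_vol D) * (\<integral>\<^sup>+s\<in>{0<..}. f s * ennreal (s ^ (D - 1)) \<partial>lborel)"
proof -
  define N where "N = density lborel
    (\<lambda>s::real. ennreal (D * unit_ball_vol D * s ^ (D - 1)) * indicator {0<..} s)"
  have D: "D \<ge> 1" by (simp add: D_def Suc_leI)
  have N: "emeasure N {..<x} = ennreal (unit_ball_vol D * x ^ D)" if x: "x > 0" for x
  proof -
    have "emeasure N {..<x} =
      (\<integral>\<^sup>+s. ennreal (D * unit_ball_vol D * s ^ (D - 1)) * indicator {0<..} s * indicator {..<x} s \<partial>lborel)"
      by (simp add: N_def emeasure_density)
    \<comment> \<open>The two integrands differ at most at the endpoints 0 and \<open>x\<close>, a
      null set; the closed interval is the form in which the fundamental theorem of calculus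
      applies.\<close>
    also have "\<dots> = (\<integral>\<^sup>+s. ennreal (D * unit_ball_vol D * s ^ (D - 1)) * indicator {0..x} s \<partial>lborel)"
    proof (rule nn_integral_cong_AE)
      show "AE s in lborel. ennreal (D * unit_ball_vol D * s ^ (D - 1)) * indicator {0<..} s * indicator {..<x} s
        = ennreal (D * unit_ball_vol D * s ^ (D - 1)) * indicator {0..x} s"
        using AE_lborel_singleton[of 0] AE_lborel_singleton[of x]
        by eventually_elim (auto split: split_indicator)
    qed
    also have "\<dots> = unit_ball_vol D * x ^ D - unit_ball_vol D * 0 ^ D"
      using x D by (intro nn_integral_FTC_Icc) (auto intro!: derivative_eq_intros mult_nonneg_nonneg)
    finally show ?thesis using D by (simp add: power_0_left)
  qed
  have N0: "emeasure N {..<x} = 0" if x: "x \<le> 0" for x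
    using x by (auto simp: N_def emeasure_density nn_integral_0_iff_AE indicator_def)
  have "(\<integral>\<^sup>+y. f (norm (y::'a)) \<partial>lborel) = (\<integral>\<^sup>+t. f t \<partial>N)"
  proof (rule nn_integral_distr_eqI)
    show "emeasure lborel {y \<in> space lborel. norm (y::'a) < x} = emeasure N {..<x}" for x
    proof (cases "x > 0")
      case True
      have "{y \<in> space lborel. norm (y::'a) < x} = ball 0 x" by auto
      with True show ?thesis by (simp add: N emeasure_ball D_def)
    next
      case False
      then have "{y \<in> space lborel. norm (y::'a) < x} = {}"
        by (auto simp: not_less) (meson dual_order.trans leD norm_ge_zero)
      with False show ?thesis by (simp only:) (simp add: N0)
    qed
    show "emeasure N {..<x} < \<infinity>" for x
      using N[of x] N0[of x] by (cases "x > 0") auto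
  qed (use f in \<open>auto simp: N_def\<close>)
  also have "\<dots> = (\<integral>\<^sup>+s. ennreal (D * unit_ball_vol D) * (f s * ennreal (s ^ (D - 1)) * indicator {0<..} s) \<partial>lborel)"
    unfolding N_def using f
    by (subst nn_integral_density)
      (auto intro!: nn_integral_cong simp: indicator_def ennreal_mult mult_ac)
  also have "\<dots> = ennreal (D * unit_ball_vol D) * (\<integral>\<^sup>+s\<in>{0<..}. f s * ennreal (s ^ (D - 1)) \<partial>lborel)"
    using f by (intro nn_integral_cmult) auto
  finally show ?thesis .
qed

subsection \<open>The tail function \<open>L\<close>\<close>

text \<open>The dimension enters only as the exponent \<open>d\<close>, later set to
  \<open>DIM('a)\<close>, so that the study of \<open>L\<close> is analysis on the
  half-line.\<close>

locale scale_function =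
  fixes l :: "real \<Rightarrow> real" and cL cU \<gamma> :: real and d :: nat
  assumes cL_pos: "0 < cL" and \<gamma>_pos: "0 < \<gamma>" and \<gamma>_less: "\<gamma> < 2"
    and l_meas: "l \<in> borel_measurable (restrict_space borel {0<..})"
    and l_pos: "\<And>s. s > 0 \<Longrightarrow> l s > 0"
    and l_int_0: "(\<integral>\<^sup>+s\<in>{0<..}. ennreal (l s / s) \<partial>lborel) = \<infinity>"
    and l_int: "\<And>r. r > 0 \<Longrightarrow> (\<integral>\<^sup>+s\<in>{r<..}. ennreal (l s / s) \<partial>lborel) < \<infinity>"
    and l_lower: "\<And>r t. r > 0 \<Longrightarrow> t \<ge> 1 \<Longrightarrow> l (r * t) / l r \<ge> cL * t powr (- \<gamma>)"
    and l_upper: "\<And>r t. r > 0 \<Longrightarrow> t \<ge> 1 \<Longrightarrow> l (r * t) / l r \<le> cU * t ^ d"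
begin

abbreviation L :: "real \<Rightarrow> real" where "L \<equiv> L_fun l"

text \<open>Nothing is known about \<open>l\<close> and \<open>L\<close> on \<open>{..0}\<close>, so measurability requires a cut-off.\<close>

lemma l_indicator_measurable [measurable]: "(\<lambda>s. indicator {0<..} s * l s) \<in> borel_measurable borel"
  using l_meas by (subst (asm) borel_measurable_restrict_space_iff) auto

lemma l_density_measurable:
  assumes "A \<in> sets borel" "A \<subseteq> {0<..}"
  shows "(\<lambda>s. ennreal (l s / s) * indicator A s) \<in> borel_measurable borel"
proof -
  have "(\<lambda>s. ennreal (l s / s) * indicator A s) =
    (\<lambda>s. ennreal ((indicator {0<..} s * l s) / s) * indicator A s)"
    using assms(2) by (auto simp: fun_eq_iff split: split_indicator)
  also have "\<dots> \<in> borel_measurable borel" using assms(1) by measurable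
  finally show ?thesis .
qed

section \<open>Power bounds for \<open>l\<close>\<close>

lemma l_le: "0 < s \<Longrightarrow> s \<le> t \<Longrightarrow> l t \<le> cU * (t / s) ^ d * l s"
  using l_upper[of s "t / s"] l_pos[of s] by (simp add: field_simps)

lemma l_ge: "0 < s \<Longrightarrow> s \<le> t \<Longrightarrow> cL * (t / s) powr (-\<gamma>) * l s \<le> l t"
  using l_lower[of s "t / s"] l_pos[of s] by (simp add: field_simps)

lemma cU_pos: "0 < cU"
  using l_upper[of 1 1] l_pos[of 1] by simp

lemma powr_\<gamma>_le: "1 \<le> t \<Longrightarrow> t powr \<gamma> \<le> t\<^sup>2"
  using powr_mono[of \<gamma> 2 t] \<gamma>_less by (simp add: powr_numeral)

text \<open>For ratios at least 1 the exponent \<gamma> < 2 may be enlarged to 2. This integer form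
  suffices at comparable radii; the exact \<gamma> returns only where integrability at the origin is
  at stake.\<close>

lemma l_ge_sq:
  assumes "0 < s" "s \<le> t"
  shows "cL * l s \<le> (t / s)\<^sup>2 * l t"
proof -
  have "cL * l s \<le> (t / s) powr \<gamma> * l t"
    using l_ge[OF assms] assms by (simp add: powr_minus field_simps)
  also have "\<dots> \<le> (t / s)\<^sup>2 * l t"
    using powr_\<gamma>_le[of "t / s"] assms l_pos[of t] by (intro mult_right_mono) auto
  finally show ?thesis .
qed

text \<open>\<open>L_fun\<close> is a Bochner integral, which is 0 by default for non-integrable
  functions. Finiteness from \<open>l_int\<close> excludes the default, and \<open>L\<close> can
  henceforth be computed with nonnegative integrals.\<close>

lemma L_nn:
  assumes "r > 0"
  shows "(\<integral>\<^sup>+s\<in>{r<..}. ennreal (l s / s) \<partial>lborel) = ennreal (L r)"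
proof -
  have *: "ennreal (indicator {r<..} s *\<^sub>R (l s / s)) = ennreal (l s / s) * indicator {r<..} s" for s
    by (auto split: split_indicator)
  have m: "(\<lambda>s. indicator {r<..} s *\<^sub>R (l s / s)) \<in> borel_measurable lborel"
  proof -
    have "(\<lambda>s. indicator {r<..} s *\<^sub>R (l s / s)) =
        (\<lambda>s. indicator {r<..} s *\<^sub>R ((indicator {0<..} s * l s) / s))"
      using assms by (auto simp: fun_eq_iff split: split_indicator)
    also have "\<dots> \<in> borel_measurable lborel" by measurable
    finally show ?thesis .
  qed
  have "L r = enn2real (\<integral>\<^sup>+s. ennreal (indicator {r<..} s *\<^sub>R (l s / s)) \<partial>lborel)"
    unfolding L_fun_def set_lebesgue_integral_def
    using assms l_pos by (intro integral_eq_nn_integral m) (auto split: split_indicator intro!: less_imp_le)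
  then show ?thesis
    using l_int[OF assms] unfolding * by (simp add: less_top)
qed

section \<open>Monotonicity and increments of \<open>L\<close>\<close>

lemma L_nonneg: "r > 0 \<Longrightarrow> 0 \<le> L r"
  unfolding L_fun_def set_lebesgue_integral_def using l_pos
  by (intro integral_nonneg_AE AE_I2) (auto split: split_indicator intro!: less_imp_le)

lemma L_split:
  assumes "0 < r" "r \<le> t"
  shows "(\<integral>\<^sup>+s\<in>{r<..t}. ennreal (l s / s) \<partial>lborel) = ennreal (L r - L t)"
proof -
  have "(\<integral>\<^sup>+s\<in>{r<..}. ennreal (l s / s) \<partial>lborel) =
    (\<integral>\<^sup>+s. ennreal (l s / s) * indicator {r<..t} s + ennreal (l s / s) * indicator {t<..} s \<partial>lborel)"
    using assms by (intro nn_integral_cong) (auto split: split_indicator)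
  also have "\<dots> = (\<integral>\<^sup>+s\<in>{r<..t}. ennreal (l s / s) \<partial>lborel) + (\<integral>\<^sup>+s\<in>{t<..}. ennreal (l s / s) \<partial>lborel)"
    using assms by (intro nn_integral_add) (auto intro!: l_density_measurable)
  finally have "ennreal (L r) = (\<integral>\<^sup>+s\<in>{r<..t}. ennreal (l s / s) \<partial>lborel) + ennreal (L t)"
    using assms by (simp add: L_nn)
  then show ?thesis
    using L_nonneg[of t] assms by (simp add: ennreal_minus[symmetric])
qed

lemma L_antimono:
  assumes "0 < r" "r \<le> t" shows "L t \<le> L r"
proof -
  have "ennreal (L t) \<le> ennreal (L r)"
    using assms by (simp add: L_nn[symmetric]) (intro nn_integral_mono, auto split: split_indicator)
  then show ?thesis using L_nonneg[of r] assms by simp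
qed

text \<open>With \<open>L_diff_le\<close>, a substitute for the mean value theorem: \<open>l\<close>
  is only measurable, so increments of \<open>L\<close> are estimated by integrating a constant
  bound on \<open>l s / s\<close>.\<close>

lemma L_diff_ge:
  assumes "0 < r" "r \<le> t" "\<And>s. r < s \<Longrightarrow> s \<le> t \<Longrightarrow> m \<le> l s / s" "0 \<le> m"
  shows "m * (t - r) \<le> L r - L t"
proof -
  have "ennreal (m * (t - r)) = (\<integral>\<^sup>+s\<in>{r<..t}. ennreal m \<partial>lborel)"
    using assms by (simp add: nn_integral_cmult_indicator ennreal_mult)
  also have "\<dots> \<le> (\<integral>\<^sup>+s\<in>{r<..t}. ennreal (l s / s) \<partial>lborel)"
    using assms by (intro nn_integral_mono) (auto split: split_indicator intro!: ennreal_leI)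
  finally show ?thesis
    using assms L_antimono by (simp add: L_split)
qed

lemma L_diff_le:
  assumes "0 < r" "r \<le> t" "\<And>s. r < s \<Longrightarrow> s \<le> t \<Longrightarrow> l s / s \<le> m" "0 \<le> m"
  shows "L r - L t \<le> m * (t - r)"
proof -
  have "ennreal (L r - L t) \<le> (\<integral>\<^sup>+s\<in>{r<..t}. ennreal m \<partial>lborel)"
    unfolding L_split[OF assms(1,2), symmetric]
    using assms by (intro nn_integral_mono) (auto split: split_indicator intro!: ennreal_leI)
  also have "\<dots> = ennreal (m * (t - r))"
    using assms by (simp add: nn_integral_cmult_indicator ennreal_mult)
  finally show ?thesis
    using assms by simp
qed

lemma L_strict_antimono:
  assumes "0 < r" "r < t" shows "L t < L r"
proof -
  \<comment> \<open>A positive lower bound for \<open>l s / s\<close> on the interval: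
    \<open>l_ge_sq\<close> is applied with ratio \<open>s / r\<close> at most \<open>t / r\<close>,
    and the denominator \<open>s\<close> is at most \<open>t\<close>.\<close>
  define m where "m = cL * l r / (t / r)\<^sup>2 / t"
  have m: "m > 0" using assms cL_pos l_pos by (simp add: m_def)
  have "m * (t - r) \<le> L r - L t"
  proof (rule L_diff_ge)
    fix s assume s: "r < s" "s \<le> t"
    have "cL * l r \<le> (s / r)\<^sup>2 * l s" using s assms by (intro l_ge_sq) auto
    also have "\<dots> \<le> (t / r)\<^sup>2 * l s"
      using s assms l_pos[of s] by (intro mult_right_mono power_mono divide_right_mono) auto
    finally have "cL * l r / (t / r)\<^sup>2 \<le> l s" using assms by (simp add: field_simps)
    then show "m \<le> l s / s"
      unfolding m_def using s assms l_pos[of s] cL_pos by (intro frac_le) auto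
  qed (use m assms in auto)
  then show ?thesis using m assms by (smt (verit) mult_pos_pos)
qed

lemma L_less_iff: "0 < s \<Longrightarrow> 0 < t \<Longrightarrow> L s < L t \<longleftrightarrow> t < s"
  using L_strict_antimono L_antimono by (meson not_le)

lemma L_pos: "r > 0 \<Longrightarrow> 0 < L r"
  using L_strict_antimono[of r "r + 1"] L_nonneg[of "r + 1"] by simp

text \<open>On (r, 2r] the density \<open>l s / s\<close> is at least
  \<open>cL * l r / (8 * r)\<close>, and this interval of length r already contributes
  \<open>cL * l r / 8\<close> to \<open>L r\<close>.\<close>

lemma l_le_L:
  assumes "0 < r" shows "cL * l r \<le> 8 * L r"
proof -
  have "cL * l r / 4 / (2 * r) * (2 * r - r) \<le> L r - L (2 * r)"
  proof (rule L_diff_ge)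
    fix s assume s: "r < s" "s \<le> 2 * r"
    have "cL * l r \<le> (s / r)\<^sup>2 * l s" using s assms by (intro l_ge_sq) auto
    also have "\<dots> \<le> 2\<^sup>2 * l s"
      using s assms l_pos[of s] by (intro mult_right_mono power_mono) (auto simp: field_simps)
    finally show "cL * l r / 4 / (2 * r) \<le> l s / s"
      using s assms l_pos[of s] cL_pos by (intro frac_le) auto
  qed (use assms cL_pos l_pos[of r] in auto)
  then have "cL * l r / 8 \<le> L r - L (2 * r)" using assms by (simp add: field_simps)
  with L_pos[of "2 * r"] assms show ?thesis by linarith
qed

text \<open>\<open>L\<close> is Lipschitz on (x/2, 2x), because \<open>l u / u\<close> is bounded
  there. The 4 in \<open>C\<close> bounds the ratio of \<open>u\<close> to
  \<open>x / 2\<close>.\<close>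

lemma isCont_L:
  assumes "x > 0" shows "isCont L x"
proof -
  define C where "C = cU * 4 ^ d * l (x / 2) / (x / 2)"
  have C: "C > 0" using assms cU_pos l_pos[of "x / 2"] by (simp add: C_def)
  have *: "L s - L t \<le> C * (t - s)" if "x / 2 < s" "s \<le> t" "t < 2 * x" for s t
  proof (rule L_diff_le)
    fix u assume u: "s < u" "u \<le> t"
    have "l u \<le> cU * (u / (x / 2)) ^ d * l (x / 2)" using u that assms by (intro l_le) auto
    also have "\<dots> \<le> cU * 4 ^ d * l (x / 2)"
      using u that assms cU_pos l_pos[of "x / 2"]
      by (intro mult_right_mono mult_left_mono power_mono) (auto simp: field_simps)
    finally show "l u / u \<le> C"
      unfolding C_def using u that assms cU_pos l_pos[of u] l_pos[of "x / 2"] by (intro frac_le) auto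
  qed (use that assms C in auto)
  have "\<bar>L y - L x\<bar> \<le> C * \<bar>y - x\<bar>" if "x / 2 < y" "y < 2 * x" for y
    using *[of x y] *[of y x] that assms L_antimono[of x y] L_antimono[of y x]
    by (cases "x \<le> y") auto
  then have "\<forall>\<^sub>F y in at x. norm (L y - L x) \<le> C * \<bar>y - x\<bar>"
    unfolding eventually_at
  proof (intro exI[of _ "x / 2"] conjI ballI impI)
    fix y assume "y \<noteq> x \<and> dist y x < x / 2"
    then have "x / 2 < y" "y < 2 * x" by (auto simp: dist_real_def abs_if split: if_splits)
    then show "norm (L y - L x) \<le> C * \<bar>y - x\<bar>"
      using \<open>\<And>y. x / 2 < y \<Longrightarrow> y < 2 * x \<Longrightarrow> \<bar>L y - L x\<bar> \<le> C * \<bar>y - x\<bar>\<close> by simp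
  qed (use assms in auto)
  moreover have "((\<lambda>y. C * \<bar>y - x\<bar>) \<longlongrightarrow> 0) (at x)" by (auto intro!: tendsto_eq_intros)
  ultimately show ?thesis
    unfolding isCont_def Lim_null[of L] by (rule Lim_null_comparison)
qed

text \<open>By monotone convergence along the radii 1/(i+1), a bound on \<open>L\<close> would bound
  the integral over the whole half-line, contrary to \<open>l_int_0\<close>.\<close>

lemma L_unbounded: "\<exists>r>0. M < L r"
proof (rule ccontr)
  assume "\<not> ?thesis"
  then have M: "L r \<le> M" if "r > 0" for r using that by (meson not_less)
  have "(\<integral>\<^sup>+s\<in>{0<..}. ennreal (l s / s) \<partial>lborel) =
    (\<integral>\<^sup>+s. (SUP i. ennreal (l s / s) * indicator {inverse (real (Suc i))<..} s) \<partial>lborel)"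
  proof (intro nn_integral_cong antisym)
    fix s :: real
    show "ennreal (l s / s) * indicator {0<..} s
      \<le> (SUP i. ennreal (l s / s) * indicator {inverse (real (Suc i))<..} s)"
    proof (cases "s > 0")
      case True
      then obtain i where "inverse (real (Suc i)) < s" using reals_Archimedean by blast
      with True show ?thesis by (intro SUP_upper2[of i]) auto
    qed auto
    have "indicator {inverse (real (Suc i))<..} s \<le> (indicator {0<..} s :: ennreal)" for i
    proof (rule indicator_leI)
      assume "s \<in> {inverse (real (Suc i))<..}"
      moreover have "0 < inverse (real (Suc i))" by simp
      ultimately have "0 < s" by (metis greaterThan_iff less_trans)
      then show "s \<in> {0<..}" by simp
    qed
    then show "(SUP i. ennreal (l s / s) * indicator {inverse (real (Suc i))<..} s)
      \<le> ennreal (l s / s) * indicator {0<..} s"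
      by (intro SUP_least mult_left_mono) simp_all
  qed
  also have "\<dots> = (SUP i. \<integral>\<^sup>+s. ennreal (l s / s) * indicator {inverse (real (Suc i))<..} s \<partial>lborel)"
  proof (rule nn_integral_monotone_convergence_SUP)
    have "indicator {inverse (real (Suc i))<..} s \<le> (indicator {inverse (real (Suc j))<..} s :: ennreal)"
      if "i \<le> j" for i j s
    proof (rule indicator_leI)
      have "inverse (real (Suc j)) \<le> inverse (real (Suc i))" using that by (simp add: field_simps)
      moreover assume "s \<in> {inverse (real (Suc i))<..}"
      ultimately show "s \<in> {inverse (real (Suc j))<..}"
        unfolding greaterThan_iff by (rule le_less_trans)
    qed
    then show "incseq (\<lambda>i s. ennreal (l s / s) * indicator {inverse (real (Suc i))<..} s)"
      unfolding incseq_def le_fun_def by (intro allI impI mult_left_mono) simp_all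
    show "(\<lambda>s. ennreal (l s / s) * indicator {inverse (real (Suc i))<..} s) \<in> borel_measurable lborel" for i
    proof -
      have "0 < inverse (real (Suc i))" by simp
      then have "{inverse (real (Suc i))<..} \<subseteq> {0<..}" by (meson greaterThan_subset_iff less_imp_le)
      then show ?thesis by (simp add: l_density_measurable del: of_nat_Suc)
    qed
  qed
  also have "\<dots> \<le> ennreal M"
    by (intro SUP_least) (simp add: L_nn M ennreal_leI del: of_nat_Suc)
  finally show False using l_int_0 by (simp add: top_unique)
qed

text \<open>The integrals over (1, i+1] increase to \<open>L 1\<close>. If \<open>L\<close> stayed
  above \<epsilon>, each of them would be at most \<open>L 1 - \<epsilon>\<close>, and so would
  their limit.\<close>

lemma L_small:
  assumes "\<epsilon> > 0" shows "\<exists>r>0. L r < \<epsilon>"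
proof (rule ccontr)
  assume "\<not> ?thesis"
  then have M: "\<epsilon> \<le> L r" if "r > 0" for r using that by (meson not_less)
  have "(\<integral>\<^sup>+s\<in>{1<..}. ennreal (l s / s) \<partial>lborel) =
    (\<integral>\<^sup>+s. (SUP i. ennreal (l s / s) * indicator {1<..real (Suc i)} s) \<partial>lborel)"
  proof (intro nn_integral_cong antisym)
    fix s :: real
    show "ennreal (l s / s) * indicator {1<..} s
      \<le> (SUP i. ennreal (l s / s) * indicator {1<..real (Suc i)} s)"
    proof (cases "s > 1")
      case True
      obtain i where "s \<le> real i" using real_arch_simple by blast
      with True show ?thesis by (intro SUP_upper2[of i]) auto
    qed auto
    show "(SUP i. ennreal (l s / s) * indicator {1<..real (Suc i)} s)
      \<le> ennreal (l s / s) * indicator {1<..} s"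
      by (intro SUP_least) (auto split: split_indicator)
  qed
  also have "\<dots> = (SUP i. \<integral>\<^sup>+s. ennreal (l s / s) * indicator {1<..real (Suc i)} s \<partial>lborel)"
  proof (rule nn_integral_monotone_convergence_SUP)
    show "incseq (\<lambda>i s. ennreal (l s / s) * indicator {1<..real (Suc i)} s)"
      unfolding incseq_def le_fun_def
      by (intro allI impI mult_left_mono) (auto split: split_indicator)
  qed (auto intro!: l_density_measurable)
  also have "\<dots> \<le> ennreal (L 1 - \<epsilon>)"
    by (intro SUP_least) (simp add: L_split M ennreal_leI del: of_nat_Suc)
  finally show False using L_pos[of 1] M[of 1] assms by (simp add: L_nn)
qed

section \<open>The inverse of \<open>L\<close> and the radius \<open>phi\<close>\<close>

lemma L_surj:
  assumes "y > 0" shows "\<exists>s>0. L s = y"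
proof -
  obtain a b where ab: "a > 0" "y < L a" "b > 0" "L b < y"
    using L_unbounded L_small[OF assms] by blast
  then have "a < b" using L_less_iff[of b a] by simp
  then obtain s where "a \<le> s" "s \<le> b" "L s = y"
    using IVT2[of L b y a] ab isCont_L by auto
  then show ?thesis using ab by (intro exI[of _ s]) auto
qed

lemma inj_on_L: "inj_on L {0<..}"
  by (rule inj_onI) (metis L_strict_antimono greaterThan_iff less_irrefl linorder_neqE)

text \<open>\<open>L_inv\<close> is meaningful only at values attained by \<open>L\<close>;
  surjectivity onto the positive reals is used for this. Later arguments see \<open>phi\<close> only
  through these facts and \<open>phi_ge\<close>.\<close>

lemma phi_props:
  assumes "a > 1" "r > 0"
  shows "0 < phi l a r" "L (phi l a r) = L r / a" "r < phi l a r"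
proof -
  have "L r / a > 0" using assms L_pos by simp
  then have *: "L r / a \<in> L ` {0<..}" using L_surj by (metis greaterThan_iff imageI)
  show 1: "0 < phi l a r"
    using the_inv_into_into[OF inj_on_L * order_refl] by (simp add: phi_def L_inv_def)
  show 2: "L (phi l a r) = L r / a"
    using f_the_inv_into_f[OF inj_on_L *] by (simp add: phi_def L_inv_def)
  have "L r / a < L r" using assms L_pos[of r] by (simp add: field_simps)
  then show "r < phi l a r" using 1 2 assms L_less_iff[of "phi l a r" r] by simp
qed

lemma L_measurable [measurable]: "(\<lambda>s. indicator {0<..} s * L s) \<in> borel_measurable borel"
  using borel_measurable_continuous_on_indicator[of "{0<..}" L] isCont_L
  by (auto simp: continuous_at_imp_continuous_on)

text \<open>For x > 0 choose \<open>s0\<close> with \<open>L s0 = x\<close>. As \<open>L\<close>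
  decreases strictly, \<open>L s < x\<close> means \<open>s > s0\<close>, and that half-line has
  mass \<open>L s0 = x\<close> under \<open>l s / s\<close>. Hence the image measure is Lebesgue
  measure on the positive half-line.\<close>

lemma nn_integral_L:
  assumes g: "g \<in> borel_measurable borel"
  shows "(\<integral>\<^sup>+s\<in>{0<..}. g (L s) * ennreal (l s / s) \<partial>lborel) = (\<integral>\<^sup>+t\<in>{0<..}. g t \<partial>lborel)"
proof -
  define M where "M = density lborel (\<lambda>s. ennreal (l s / s) * indicator {0<..} s)"
  define N where "N = density lborel (indicator {0::real<..})"
  have dm: "(\<lambda>s. ennreal (l s / s) * indicator {0<..} s) \<in> borel_measurable lborel"
    by (simp add: l_density_measurable)
  have N: "emeasure N {..<x} = ennreal x" for x
  proof -
    have "emeasure N {..<x} = (\<integral>\<^sup>+s. indicator {0<..} s * indicator {..<x} s \<partial>lborel)"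
      unfolding N_def by (rule emeasure_density) simp_all
    also have "\<dots> = (\<integral>\<^sup>+s. indicator {0<..<x} s \<partial>lborel)"
      by (rule nn_integral_cong) (simp split: split_indicator)
    also have "\<dots> = ennreal x" by (cases "0 \<le> x") (simp_all add: ennreal_neg)
    finally show ?thesis .
  qed
  have gL: "(\<lambda>s. g (indicator {0<..} s * L s)) \<in> borel_measurable borel"
    using measurable_compose[OF L_measurable g] .
  have "(\<integral>\<^sup>+s. g (indicator {0<..} s * L s) \<partial>M) = (\<integral>\<^sup>+t. g t \<partial>N)"
  proof (rule nn_integral_distr_eqI)
    show "emeasure M {s \<in> space M. indicator {0<..} s * L s < x} = emeasure N {..<x}" for x
    proof -
      have "emeasure M {s \<in> space M. indicator {0<..} s * L s < x} = (\<integral>\<^sup>+s. ennreal (l s / s) * indicator {0<..} s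
        * indicator {s. indicator {0<..} s * L s < x} s \<partial>lborel)"
        unfolding M_def using dm by (subst emeasure_density) simp_all
      also have "\<dots> = ennreal x"
      proof (cases "x > 0")
        case True
        then obtain s0 where s0: "s0 > 0" "L s0 = x" using L_surj by blast
        have "(\<integral>\<^sup>+s. ennreal (l s / s) * indicator {0<..} s
          * indicator {s. indicator {0<..} s * L s < x} s \<partial>lborel) =
          (\<integral>\<^sup>+s\<in>{s0<..}. ennreal (l s / s) \<partial>lborel)"
          using s0 L_less_iff[of _ s0] by (intro nn_integral_cong) (auto split: split_indicator)
        with s0 show ?thesis by (simp add: L_nn)
      next
        case False
        then have "\<not> L s < x" if "s > 0" for s using L_pos[OF that] by simp
        then have *: "ennreal (l s / s) * indicator {0<..} s
          * indicator {s. indicator {0<..} s * L s < x} s = 0" for s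
          by (auto split: split_indicator)
        show ?thesis using False by (simp add: * ennreal_neg)
      qed
      finally show ?thesis by (simp add: N)
    qed
  qed (use g in \<open>simp_all add: N\<close>, simp_all add: M_def N_def)
  moreover have "(\<integral>\<^sup>+s. g (indicator {0<..} s * L s) \<partial>M) =
    (\<integral>\<^sup>+s\<in>{0<..}. g (L s) * ennreal (l s / s) \<partial>lborel)"
  proof -
    have "(\<integral>\<^sup>+s. g (indicator {0<..} s * L s) \<partial>M) =
      (\<integral>\<^sup>+s. ennreal (l s / s) * indicator {0<..} s * g (indicator {0<..} s * L s) \<partial>lborel)"
      unfolding M_def using gL dm by (intro nn_integral_density) simp_all
    also have "\<dots> = (\<integral>\<^sup>+s\<in>{0<..}. g (L s) * ennreal (l s / s) \<partial>lborel)"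
      by (rule nn_integral_cong) (simp add: mult.commute split: split_indicator)
    finally show ?thesis .
  qed
  moreover have "(\<integral>\<^sup>+t. g t \<partial>N) = (\<integral>\<^sup>+t\<in>{0<..}. g t \<partial>lborel)"
    unfolding N_def using g by (subst nn_integral_density) (simp_all add: mult.commute)
  ultimately show ?thesis by simp
qed

end

subsection \<open>Radial integrals\<close>

text \<open>The \<open>itself\<close> argument carries the dimension, which a real constant cannot
  reveal by its type.\<close>

definition sphere_area :: "'a::euclidean_space itself \<Rightarrow> real" where
  "sphere_area _ = DIM('a) * unit_ball_vol DIM('a)"

lemma sphere_area_pos: "sphere_area TYPE('a::euclidean_space) > 0"
  by (simp add: sphere_area_def)

lemma nn_integral_powr_from_0:
  assumes "p > -1" "0 \<le> c"
  shows "(\<integral>\<^sup>+t\<in>{0<..c}. ennreal (t powr p) \<partial>lborel) = ennreal (c powr (p + 1) / (p + 1))"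
proof -
  have "integral\<^sup>N lborel (\<lambda>t. ennreal (indicator {0..c} t * t powr p)) = ennreal (c powr (p + 1) / (p + 1))"
  proof (rule nn_integral_has_integral_lborel)
    have "(\<lambda>t. indicator {0..c} t * t powr p) = (\<lambda>t. if t \<in> {0..c} then t powr p else 0)"
      by auto
    then show "((\<lambda>t. indicator {0..c} t * t powr p) has_integral c powr (p + 1) / (p + 1)) UNIV"
      using has_integral_powr_from_0[OF assms] by (simp only: has_integral_restrict_UNIV)
  qed auto
  \<comment> \<open>At \<open>t = 0\<close> both sides vanish, by the convention that
    \<open>0 powr p\<close> is 0, even for negative p.\<close>
  moreover have "ennreal (indicator {0..c} t * t powr p) = ennreal (t powr p) * indicator {0<..c} t" for t
    by (cases "t = 0") (auto split: split_indicator)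
  ultimately show ?thesis by simp
qed

lemma norm_borel_measurable: "(norm :: 'a::euclidean_space \<Rightarrow> real) \<in> borel_measurable borel"
  by measurable

locale radial_kernel = scale_function l cL cU \<gamma> "DIM('a)"
  for l :: "real \<Rightarrow> real" and cL cU \<gamma> :: real
    and K :: "'a::euclidean_space \<Rightarrow> 'a \<Rightarrow> real" and \<kappa> K0 :: real +
  assumes \<kappa>_ge: "\<kappa> \<ge> 1"
    and K_meas: "(\<lambda>(x, h). K x h) \<in> borel_measurable (restrict_space borel (UNIV \<times> - {0}))"
    and K_nonneg: "\<And>x h. h \<noteq> 0 \<Longrightarrow> K x h \<ge> 0"
    and K_sym: "\<And>x h. h \<noteq> 0 \<Longrightarrow> K x h = K x (- h)"
    and K_lower: "\<And>x h. h \<noteq> 0 \<Longrightarrow> inverse \<kappa> * (l (norm h) / norm h ^ DIM('a)) \<le> K x h"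
    and K_upper: "\<And>x h. h \<noteq> 0 \<Longrightarrow> K x h \<le> \<kappa> * (l (norm h) / norm h ^ DIM('a))"
    and K_int: "(SUP x. \<integral>\<^sup>+h\<in>-{0}. ennreal (min 1 ((norm h)\<^sup>2) * K x h) \<partial>lborel) \<le> ennreal K0"
begin

text \<open>The radial kernel with which \<open>K\<close> is comparable. Division by zero makes it
  vanish at the origin, so integrals over the whole space need no exception there.\<close>

definition J :: "'a \<Rightarrow> real" where
  "J y = l (norm y) / norm y ^ DIM('a)"

lemma J_measurable [measurable]: "J \<in> borel_measurable borel"
proof -
  have "J = (\<lambda>y. (indicator {0<..} (norm y) * l (norm y)) / norm y ^ DIM('a))"
    by (auto simp: J_def fun_eq_iff split: split_indicator)
  also have "\<dots> \<in> borel_measurable borel"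
    using measurable_compose[OF norm_borel_measurable l_indicator_measurable]
    by (intro borel_measurable_divide) auto
  finally show ?thesis .
qed

lemma J_0 [simp]: "J 0 = 0"
  by (simp add: J_def)

lemma J_nonneg [simp]: "0 \<le> J y"
proof (cases "y = 0")
  case False
  with l_pos[of "norm y"] show ?thesis by (simp add: J_def)
qed simp

text \<open>The Jacobian \<open>s ^ (DIM('a) - 1)\<close> of polar coordinates turns the factor
  \<open>1 / s ^ DIM('a)\<close> of \<open>J\<close> into \<open>1 / s\<close>, which is the density
  defining \<open>L\<close>.\<close>

lemma nn_integral_radial:
  assumes g: "g \<in> borel_measurable borel"
  shows "(\<integral>\<^sup>+y. g (norm y) * ennreal (J y) \<partial>lborel) =
    ennreal (sphere_area TYPE('a)) * (\<integral>\<^sup>+s\<in>{0<..}. g s * ennreal (l s / s) \<partial>lborel)"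
proof -
  define f where "f s = g s * ennreal ((indicator {0<..} s * l s) / s ^ DIM('a))" for s
  have "g (norm y) * ennreal (J y) = f (norm y)" for y
  proof (cases "y = 0")
    case False
    then show ?thesis by (simp add: f_def J_def)
  qed (simp add: f_def)
  then have "(\<integral>\<^sup>+y. g (norm y) * ennreal (J y) \<partial>lborel) = (\<integral>\<^sup>+y. f (norm (y::'a)) \<partial>lborel)"
    by simp
  also have "\<dots> = ennreal (sphere_area TYPE('a)) * (\<integral>\<^sup>+s\<in>{0<..}. f s * ennreal (s ^ (DIM('a) - 1)) \<partial>lborel)"
    unfolding sphere_area_def using g by (intro nn_integral_norm) (simp add: f_def)
  also have "(\<integral>\<^sup>+s\<in>{0<..}. f s * ennreal (s ^ (DIM('a) - 1)) \<partial>lborel) =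
    (\<integral>\<^sup>+s\<in>{0<..}. g s * ennreal (l s / s) \<partial>lborel)"
  proof (rule nn_integral_cong)
    fix s :: real
    have "ennreal (l s / s ^ DIM('a)) * ennreal (s ^ (DIM('a) - 1)) = ennreal (l s / s)" if "s > 0"
      using that l_pos[of s] power_minus_mult[of "DIM('a)" s]
      by (simp add: ennreal_mult[symmetric] field_simps)
    then show "f s * ennreal (s ^ (DIM('a) - 1)) * indicator {0<..} s =
        g s * ennreal (l s / s) * indicator {0<..} s"
      by (simp add: f_def mult.assoc split: split_indicator)
  qed
  finally show ?thesis .
qed

lemma nn_integral_radial_L:
  assumes g: "g \<in> borel_measurable borel"
  shows "(\<integral>\<^sup>+y. g (L (norm y)) * ennreal (J y) \<partial>lborel) = ennreal (sphere_area TYPE('a)) * (\<integral>\<^sup>+t\<in>{0<..}. g t \<partial>lborel)"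
proof -
  have "g (L (norm y)) * ennreal (J y) = g (indicator {0<..} (norm y) * L (norm y)) * ennreal (J y)" for y
    by (cases "y = 0") auto
  then have "(\<integral>\<^sup>+y. g (L (norm y)) * ennreal (J y) \<partial>lborel) =
    (\<integral>\<^sup>+y. g (indicator {0<..} (norm y) * L (norm y)) * ennreal (J y) \<partial>lborel)"
    by simp
  also have "\<dots> = ennreal (sphere_area TYPE('a)) *
    (\<integral>\<^sup>+s\<in>{0<..}. g (indicator {0<..} s * L s) * ennreal (l s / s) \<partial>lborel)"
    by (rule nn_integral_radial) (rule measurable_compose[OF L_measurable g])
  also have "(\<integral>\<^sup>+s\<in>{0<..}. g (indicator {0<..} s * L s) * ennreal (l s / s) \<partial>lborel) =
    (\<integral>\<^sup>+s\<in>{0<..}. g (L s) * ennreal (l s / s) \<partial>lborel)"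
    by (rule nn_integral_cong) (simp split: split_indicator)
  finally show ?thesis
    using g by (simp add: nn_integral_L)
qed

section \<open>The measure \<open>mu\<close> and the exterior growth in the variable
  \<open>t = L |y|\<close>\<close>

lemma L_norm_measurable: "(\<lambda>y::'a. indicator (- {0}) y * L (norm y)) \<in> borel_measurable borel"
proof -
  have "(\<lambda>y::'a. indicator (- {0}) y * L (norm y)) = (\<lambda>y. indicator {0<..} (norm y) * L (norm y))"
    by (auto simp: fun_eq_iff split: split_indicator)
  then show ?thesis
    using measurable_compose[OF norm_borel_measurable L_measurable] by simp
qed

lemma mu_density_measurable:
  "(\<lambda>y::'a. ennreal (l (norm y) / L (norm y) / norm y ^ DIM('a))) \<in> borel_measurable borel"
proof -
  have "(\<lambda>y::'a. ennreal (l (norm y) / L (norm y) / norm y ^ DIM('a))) =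
    (\<lambda>y. ennreal (J y / (indicator (- {0}) y * L (norm y))))"
  proof
    fix y :: 'a
    have "(0::real) ^ DIM('a) = 0" by (rule zero_power) simp
    then have "l (norm y) / L (norm y) / norm y ^ DIM('a) = J y / (indicator (- {0}) y * L (norm y))"
      by (cases "y = 0") (simp_all only: J_def, simp_all add: mult.commute)
    then show "ennreal (l (norm y) / L (norm y) / norm y ^ DIM('a)) =
      ennreal (J y / (indicator (- {0}) y * L (norm y)))" by simp
  qed
  then show ?thesis using L_norm_measurable by simp
qed

lemma emeasure_mu:
  assumes "E \<in> sets borel"
  shows "emeasure (mu l) E = (\<integral>\<^sup>+y. ennreal (J y / L (norm y)) * indicator E y \<partial>(lborel :: 'a measure))"
  using assms mu_density_measurable
  by (simp add: mu_def J_def emeasure_density mult.commute)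

text \<open>In the variable \<open>t = L |y|\<close> the measure has density 1/t, and the annulus
  becomes the interval from \<open>L \<rho>\<close> to \<open>L r\<close> since \<open>L\<close>
  reverses order. The integral of 1/t is the logarithm of the ratio, which is \<open>ln a\<close>
  when \<open>\<rho> = phi l a r\<close>.\<close>

lemma mu_annulus:
  assumes "0 < r" "r \<le> \<rho>"
  shows "emeasure (mu l) (ball 0 \<rho> - ball (0::'a) r) = ennreal (sphere_area TYPE('a) * ln (L r / L \<rho>))"
proof -
  have \<rho>: "0 < \<rho>" "0 < L \<rho>" "0 < L r" "L \<rho> \<le> L r"
    using assms L_pos L_antimono by auto
  define g where "g t = ennreal (1 / t) * indicator {L \<rho><..L r} t" for t
  have "ennreal (J y / L (norm y)) * indicator (ball 0 \<rho> - ball 0 r) y = g (L (norm y)) * ennreal (J y)" for y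
  proof (cases "y = 0")
    case False
    then have "norm y < \<rho> \<longleftrightarrow> L \<rho> < L (norm y)" "\<not> norm y < r \<longleftrightarrow> L (norm y) \<le> L r"
      using assms \<rho> L_less_iff[of \<rho> "norm y"] L_less_iff[of r "norm y"] by auto
    moreover have "L (norm y) > 0" using False L_pos by simp
    ultimately show ?thesis
      by (simp add: g_def ennreal_mult[symmetric] split: split_indicator)
  qed (use assms in simp)
  then have "emeasure (mu l) (ball 0 \<rho> - ball (0::'a) r) = (\<integral>\<^sup>+y. g (L (norm y)) * ennreal (J y) \<partial>lborel)"
    by (simp add: emeasure_mu)
  also have "\<dots> = ennreal (sphere_area TYPE('a)) * (\<integral>\<^sup>+t\<in>{0<..}. g t \<partial>lborel)"
    by (rule nn_integral_radial_L) (simp add: g_def)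
  also have "(\<integral>\<^sup>+t\<in>{0<..}. g t \<partial>lborel) = (\<integral>\<^sup>+t. ennreal (1 / t) * indicator {L \<rho>..L r} t \<partial>lborel)"
  proof (rule nn_integral_cong_AE)
    show "AE t in lborel. g t * indicator {0<..} t = ennreal (1 / t) * indicator {L \<rho>..L r} t"
      using AE_lborel_singleton[of "L \<rho>"]
      by (rule eventually_mono) (use \<rho> in \<open>auto simp: g_def split: split_indicator\<close>)
  qed
  also have "\<dots> = ennreal (ln (L r) - ln (L \<rho>))"
    using \<rho> by (intro nn_integral_FTC_Icc) (auto intro!: derivative_eq_intros)
  finally show ?thesis
    using \<rho> sphere_area_pos[where 'a='a] by (simp add: ennreal_mult[symmetric] ln_div)
qed

text \<open>Under \<open>t = L |y|\<close> the exterior of the ball becomes (0, L \<rho>] and the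
  growth bound becomes a multiple of t^(-\<eta>), whose singularity at 0 is integrable because
  \<eta> < 1. The powers of \<open>L \<rho>\<close> combine to the first power.\<close>

lemma nn_integral_tail:
  assumes "0 < \<rho>" "0 < \<eta>" "\<eta> < 1" "0 \<le> C0"
  shows "(\<integral>\<^sup>+y\<in>- ball 0 \<rho>. ennreal (C0 * (L \<rho> / L (norm y)) powr \<eta>) * ennreal (J y) \<partial>lborel)
    = ennreal (sphere_area TYPE('a) * C0 * L \<rho> / (1 - \<eta>))"
proof -
  have \<rho>: "0 < L \<rho>" using assms L_pos by auto
  define g where "g t = ennreal (C0 * (L \<rho> / t) powr \<eta>) * indicator {..L \<rho>} t" for t
  have "ennreal (C0 * (L \<rho> / L (norm y)) powr \<eta>) * ennreal (J y) * indicator (- ball 0 \<rho>) y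
    = g (L (norm y)) * ennreal (J y)" for y
  proof (cases "y = 0")
    case False
    then have "\<not> norm y < \<rho> \<longleftrightarrow> L (norm y) \<le> L \<rho>"
      using assms \<rho> L_less_iff[of \<rho> "norm y"] by auto
    then show ?thesis
      by (simp add: g_def mult_ac split: split_indicator)
  qed (use assms in simp)
  then have "(\<integral>\<^sup>+y\<in>- ball 0 \<rho>. ennreal (C0 * (L \<rho> / L (norm y)) powr \<eta>) * ennreal (J y) \<partial>lborel)
    = (\<integral>\<^sup>+y. g (L (norm y)) * ennreal (J y) \<partial>lborel)"
    by simp
  also have "\<dots> = ennreal (sphere_area TYPE('a)) * (\<integral>\<^sup>+t\<in>{0<..}. g t \<partial>lborel)"
    by (rule nn_integral_radial_L) (simp add: g_def)
  also have "(\<integral>\<^sup>+t\<in>{0<..}. g t \<partial>lborel) =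
    (\<integral>\<^sup>+t. ennreal (C0 * L \<rho> powr \<eta>) * (ennreal (t powr (-\<eta>)) * indicator {0<..L \<rho>} t) \<partial>lborel)"
  proof (rule nn_integral_cong)
    fix t
    have "ennreal (C0 * (L \<rho> / t) powr \<eta>) = ennreal (C0 * L \<rho> powr \<eta>) * ennreal (t powr (-\<eta>))" if "t > 0"
      using that \<rho> assms by (simp add: ennreal_mult[symmetric] powr_divide powr_minus field_simps)
    then show "g t * indicator {0<..} t =
      ennreal (C0 * L \<rho> powr \<eta>) * (ennreal (t powr (-\<eta>)) * indicator {0<..L \<rho>} t)"
      by (simp add: g_def split: split_indicator)
  qed
  also have "\<dots> = ennreal (C0 * L \<rho> powr \<eta>) * ennreal (L \<rho> powr (-\<eta> + 1) / (-\<eta> + 1))"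
    using assms \<rho> by (subst nn_integral_cmult) (simp_all add: nn_integral_powr_from_0)
  also have "\<dots> = ennreal (C0 * L \<rho> / (1 - \<eta>))"
  proof -
    have "L \<rho> powr \<eta> * L \<rho> powr (-\<eta> + 1) = L \<rho>"
      using \<rho> by (simp add: powr_add[symmetric])
    then show ?thesis using assms by (simp add: ennreal_mult[symmetric] mult.assoc)
  qed
  finally show ?thesis
    using assms \<rho> sphere_area_pos[where 'a='a] by (simp add: ennreal_mult[symmetric] mult.assoc)
qed

text \<open>The 1 accounts for radii beyond r. The quotient arises from the integral of
  s^(1-\<gamma>) up to r, after \<open>l_le_L\<close> replaces \<open>l r\<close> by
  \<open>8 * L r / cL\<close>.\<close>

definition Cbump :: real where "Cbump = 1 + 8 / (cL\<^sup>2 * (2 - \<gamma>))"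

lemma Cbump_pos: "Cbump > 0"
  unfolding Cbump_def using cL_pos \<gamma>_less by (intro add_pos_nonneg) auto

text \<open>The integral is split at radius r. Inside, \<open>l_ge\<close> bounds \<open>l s\<close>
  by a multiple of (r/s)^\<gamma>, leaving s^(1-\<gamma>), which is integrable as \<gamma> < 2.
  Outside, the minimum is at most 1 and the mass is \<open>L r\<close>.\<close>

lemma nn_integral_bump:
  assumes r: "0 < r"
  shows "(\<integral>\<^sup>+h. ennreal (min 1 ((norm h)\<^sup>2 / r\<^sup>2)) * ennreal (J h) \<partial>lborel) \<le> ennreal (sphere_area TYPE('a) * Cbump * L r)"
proof -
  have radial: "(\<integral>\<^sup>+h. ennreal (min 1 ((norm h)\<^sup>2 / r\<^sup>2)) * ennreal (J h) \<partial>lborel)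
    = ennreal (sphere_area TYPE('a)) * (\<integral>\<^sup>+s\<in>{0<..}. ennreal (min 1 (s\<^sup>2 / r\<^sup>2)) * ennreal (l s / s) \<partial>lborel)"
    by (rule nn_integral_radial[of "\<lambda>s. ennreal (min 1 (s\<^sup>2 / r\<^sup>2))"]) simp
  have "(\<integral>\<^sup>+s\<in>{0<..}. ennreal (min 1 (s\<^sup>2 / r\<^sup>2)) * ennreal (l s / s) \<partial>lborel) \<le>
    (\<integral>\<^sup>+s. ennreal (l r / cL * r powr (\<gamma> - 2)) * (ennreal (s powr (1 - \<gamma>)) * indicator {0<..r} s)
       + ennreal (l s / s) * indicator {r<..} s \<partial>lborel)"
  proof (rule nn_integral_mono)
    fix s :: real
    consider "s \<le> 0" | "0 < s" "s \<le> r" | "r < s" by linarith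
    then show "ennreal (min 1 (s\<^sup>2 / r\<^sup>2)) * ennreal (l s / s) * indicator {0<..} s \<le>
      ennreal (l r / cL * r powr (\<gamma> - 2)) * (ennreal (s powr (1 - \<gamma>)) * indicator {0<..r} s)
       + ennreal (l s / s) * indicator {r<..} s"
    proof cases
      case 2
      have "cL * (r / s) powr (-\<gamma>) * l s \<le> l r" using 2 by (intro l_ge) auto
      then have "cL * (s powr \<gamma> / r powr \<gamma>) * l s \<le> l r"
        using 2 r by (simp add: powr_divide powr_minus field_simps)
      then have "l s \<le> l r / cL * r powr \<gamma> / s powr \<gamma>"
        using 2 r cL_pos by (simp add: field_simps)
      then have "s\<^sup>2 / r\<^sup>2 * (l s / s) \<le> s\<^sup>2 / r\<^sup>2 * (l r / cL * r powr \<gamma> / s powr \<gamma> / s)"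
        using 2 r by (intro mult_left_mono divide_right_mono) auto
      also have "\<dots> = l r / cL * (r powr \<gamma> / r\<^sup>2) * (s / s powr \<gamma>)"
        using 2 by (simp add: power2_eq_square mult_ac)
      also have "\<dots> = l r / cL * r powr (\<gamma> - 2) * s powr (1 - \<gamma>)"
        using 2 r by (simp add: powr_diff powr_numeral)
      finally have "min 1 (s\<^sup>2 / r\<^sup>2) * (l s / s) \<le> l r / cL * r powr (\<gamma> - 2) * s powr (1 - \<gamma>)"
        using 2 l_pos[of s] by (smt (verit) divide_pos_pos mult_right_mono min.cobounded2)
      then have e1: "ennreal (min 1 (s\<^sup>2 / r\<^sup>2) * (l s / s)) \<le> ennreal (l r / cL * r powr (\<gamma> - 2) * s powr (1 - \<gamma>))"
        by (rule ennreal_leI)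
      have e2: "ennreal (min 1 (s\<^sup>2 / r\<^sup>2) * (l s / s)) = ennreal (min 1 (s\<^sup>2 / r\<^sup>2)) * ennreal (l s / s)"
        using 2 l_pos[of s] by (intro ennreal_mult) auto
      have e3: "ennreal (l r / cL * r powr (\<gamma> - 2) * s powr (1 - \<gamma>)) =
          ennreal (l r / cL * r powr (\<gamma> - 2)) * ennreal (s powr (1 - \<gamma>))"
        using r l_pos[of r] cL_pos by (intro ennreal_mult) auto
      have ind: "indicator {0<..} s = (1::ennreal)" "indicator {0<..r} s = (1::ennreal)"
          "indicator {r<..} s = (0::ennreal)"
        using 2 by auto
      show ?thesis
        using e1 unfolding e2 e3 ind by (simp only: mult_1_right mult_zero_right add_0_right)
    next
      case 3
      have "ennreal (min 1 (s\<^sup>2 / r\<^sup>2)) \<le> ennreal 1" by (rule ennreal_leI) simp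
      then have "ennreal (min 1 (s\<^sup>2 / r\<^sup>2)) * ennreal (l s / s) \<le> 1 * ennreal (l s / s)"
        by (intro mult_right_mono) auto
      moreover have ind: "indicator {0<..} s = (1::ennreal)" "indicator {0<..r} s = (0::ennreal)"
          "indicator {r<..} s = (1::ennreal)"
        using 3 r by auto
      ultimately show ?thesis
        unfolding ind by (simp only: mult_1_right mult_1_left mult_zero_right add_0_left)
    qed simp
  qed
  also have "\<dots> = ennreal (l r / cL * r powr (\<gamma> - 2)) * ennreal (r powr (1 - \<gamma> + 1) / (1 - \<gamma> + 1)) + ennreal (L r)"
  proof -
    define f where "f s = ennreal (s powr (1 - \<gamma>)) * indicator {0<..r} s" for s
    define g where "g s = ennreal (l s / s) * indicator {r<..} s" for s
    have f: "f \<in> borel_measurable lborel" unfolding f_def by simp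
    have g: "g \<in> borel_measurable lborel"
      using l_density_measurable[of "{r<..}"] r by (simp add: g_def[abs_def])
    have "(\<integral>\<^sup>+s. ennreal (l r / cL * r powr (\<gamma> - 2)) * f s + g s \<partial>lborel)
      = (\<integral>\<^sup>+s. ennreal (l r / cL * r powr (\<gamma> - 2)) * f s \<partial>lborel) + (\<integral>\<^sup>+s. g s \<partial>lborel)"
      using f g by (intro nn_integral_add) simp_all
    also have "\<dots> = ennreal (l r / cL * r powr (\<gamma> - 2)) * (\<integral>\<^sup>+s. f s \<partial>lborel) + (\<integral>\<^sup>+s. g s \<partial>lborel)"
      using nn_integral_cmult[OF f] by simp
    also have "(\<integral>\<^sup>+s. f s \<partial>lborel) = ennreal (r powr (1 - \<gamma> + 1) / (1 - \<gamma> + 1))"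
      unfolding f_def using r \<gamma>_less by (intro nn_integral_powr_from_0) auto
    also have "(\<integral>\<^sup>+s. g s \<partial>lborel) = ennreal (L r)"
      unfolding g_def by (rule L_nn[OF r])
    finally show ?thesis by (simp only: f_def g_def)
  qed
  also have "\<dots> = ennreal (l r / (cL * (2 - \<gamma>)) + L r)"
  proof -
    have e: "1 - \<gamma> + 1 = 2 - \<gamma>" by simp
    have "r powr (\<gamma> - 2) * r powr (2 - \<gamma>) = 1"
      using r by (simp add: powr_add[symmetric])
    then have "l r / cL * r powr (\<gamma> - 2) * (r powr (1 - \<gamma> + 1) / (1 - \<gamma> + 1)) = l r / (cL * (2 - \<gamma>))"
    proof -
      have "l r / cL * r powr (\<gamma> - 2) * (r powr (1 - \<gamma> + 1) / (1 - \<gamma> + 1))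
        = l r / cL * (r powr (\<gamma> - 2) * r powr (2 - \<gamma>)) / (2 - \<gamma>)"
        by (simp only: e times_divide_eq_right mult.assoc)
      with \<open>r powr (\<gamma> - 2) * r powr (2 - \<gamma>) = 1\<close> show ?thesis by (simp only: mult_1_right divide_divide_eq_left)
    qed
    then have "ennreal (l r / cL * r powr (\<gamma> - 2)) * ennreal (r powr (1 - \<gamma> + 1) / (1 - \<gamma> + 1))
      = ennreal (l r / (cL * (2 - \<gamma>)))"
      using r \<gamma>_less cL_pos l_pos[of r] by (subst ennreal_mult[symmetric]) (simp_all only:, auto)
    moreover have "ennreal (l r / (cL * (2 - \<gamma>)) + L r) = ennreal (l r / (cL * (2 - \<gamma>))) + ennreal (L r)"
      using r \<gamma>_less cL_pos l_pos[of r] L_nonneg[of r] by (intro ennreal_plus) auto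
    ultimately show ?thesis by (simp only:)
  qed
  also have "\<dots> \<le> ennreal (Cbump * L r)"
  proof (rule ennreal_leI)
    have "l r \<le> 8 * L r / cL" using l_le_L[OF r] cL_pos by (simp add: field_simps)
    then have "l r / (cL * (2 - \<gamma>)) \<le> 8 * L r / cL / (cL * (2 - \<gamma>))"
      using \<gamma>_less cL_pos by (intro divide_right_mono) auto
    then show "l r / (cL * (2 - \<gamma>)) + L r \<le> Cbump * L r"
      by (simp add: Cbump_def algebra_simps power2_eq_square)
  qed
  finally have "(\<integral>\<^sup>+h. ennreal (min 1 ((norm h)\<^sup>2 / r\<^sup>2)) * ennreal (J h) \<partial>lborel)
    \<le> ennreal (sphere_area TYPE('a)) * ennreal (Cbump * L r)"
    unfolding radial by (rule mult_left_mono) simp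
  also have "\<dots> = ennreal (sphere_area TYPE('a) * Cbump * L r)"
    using Cbump_pos sphere_area_pos[where 'a='a] L_nonneg[OF r]
    by (subst ennreal_mult[symmetric]) (simp_all add: mult.assoc)
  finally show ?thesis .
qed

text \<open>The first summand serves \<open>J_le\<close> when |z| > |y|: 9 is the square of the
  ratio 3 in \<open>l_ge_sq\<close>, and the power of 3 comes from the norms. The second serves |z|
  \<le> |y|.\<close>

definition Cshift :: real where "Cshift = 9 * 3 ^ DIM('a) / cL + cU"

lemma Cshift_pos: "Cshift > 0"
  using cL_pos cU_pos by (simp add: Cshift_def add_pos_pos)

text \<open>This allows the kernel centred at a point x near the origin to be replaced by the one
  centred at 0: the relevant displacements and positions have norms related by a factor of at most
  3.\<close>

lemma J_le:
  assumes "y \<noteq> 0" "z \<noteq> 0" "norm z \<le> 3 * norm y"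
  shows "J y \<le> Cshift * J z"
proof -
  define s t where "s = norm z" and "t = norm y"
  have st: "0 < s" "0 < t" "s \<le> 3 * t" using assms by (auto simp: s_def t_def)
  have pos: "0 < l s" "0 < l t" using st l_pos by auto
  show ?thesis
  proof (cases "s \<le> t")
    case True
    \<comment> \<open>The growth (t/s)^d permitted here is exactly compensated by the powers of the
      norms in \<open>J\<close>.\<close>
    have "l t \<le> cU * (t / s) ^ DIM('a) * l s" using st True by (intro l_le)
    then have "J y \<le> cU * J z"
      using st by (simp add: J_def s_def[symmetric] t_def[symmetric] field_simps power_divide)
    also have "\<dots> \<le> Cshift * J z"
      using cL_pos by (intro mult_right_mono) (auto simp: Cshift_def)
    finally show ?thesis .
  next
    case False
    have "cL * l t \<le> (s / t)\<^sup>2 * l s" using st False by (intro l_ge_sq) auto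
    also have "\<dots> \<le> 3\<^sup>2 * l s"
      using st pos by (intro mult_right_mono power_mono) (auto simp: field_simps)
    finally have 1: "l t \<le> 9 / cL * l s" using cL_pos by (simp add: field_simps)
    have "s ^ DIM('a) \<le> (3 * t) ^ DIM('a)" using st by (intro power_mono) auto
    then have 2: "1 / t ^ DIM('a) \<le> 3 ^ DIM('a) / s ^ DIM('a)"
      using st by (simp add: field_simps power_mult_distrib)
    have "J y = l t * (1 / t ^ DIM('a))" by (simp add: J_def t_def)
    also have "\<dots> \<le> (9 / cL * l s) * (3 ^ DIM('a) / s ^ DIM('a))"
      using 1 2 st pos cL_pos by (intro mult_mono) auto
    also have "\<dots> = 9 * 3 ^ DIM('a) / cL * J z" by (simp add: J_def s_def)
    also have "\<dots> \<le> Cshift * J z"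
      using cU_pos by (intro mult_right_mono) (auto simp: Cshift_def)
    finally show ?thesis .
  qed
qed

text \<open>Comparing \<open>l s\<close> with \<open>l (4 * s)\<close> and rescaling the integral by
  4 gives \<open>cL / 16 * L r \<le> L (4 * r)\<close>. For large a this exceeds
  \<open>L r / a = L (phi l a r)\<close>, and \<open>L\<close> is decreasing. It leaves room around
  \<open>ball 0 (2 * r)\<close> inside the large ball.\<close>

lemma phi_ge:
  assumes "r > 0" "a > 1" "a \<ge> 16 / cL"
  shows "4 * r \<le> phi l a r"
proof -
  have "ennreal (cL / 16 * L r) = (\<integral>\<^sup>+s. ennreal (cL / 16) * (ennreal (l s / s) * indicator {r<..} s) \<partial>lborel)"
  proof (subst nn_integral_cmult)
    show "(\<lambda>s. ennreal (l s / s) * indicator {r<..} s) \<in> borel_measurable lborel"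
      using assms by (simp add: l_density_measurable)
    show "ennreal (cL / 16 * L r) = ennreal (cL / 16) * (\<integral>\<^sup>+s\<in>{r<..}. ennreal (l s / s) \<partial>lborel)"
      unfolding L_nn[OF assms(1)] using assms(1) cL_pos L_nonneg[of r] by (intro ennreal_mult) auto
  qed
  also have "\<dots> \<le> (\<integral>\<^sup>+s. ennreal 4 * (ennreal (l (4 * s) / (4 * s)) * indicator {4 * r<..} (4 * s)) \<partial>lborel)"
  proof (rule nn_integral_mono)
    fix s
    show "ennreal (cL / 16) * (ennreal (l s / s) * indicator {r<..} s) \<le>
      ennreal 4 * (ennreal (l (4 * s) / (4 * s)) * indicator {4 * r<..} (4 * s))"
    proof (cases "s > r")
      case True
      then have "cL * l s \<le> (4 * s / s)\<^sup>2 * l (4 * s)" using assms by (intro l_ge_sq) auto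
      then have "cL / 16 * (l s / s) \<le> 4 * (l (4 * s) / (4 * s))"
        using True assms by (simp add: field_simps)
      then have "ennreal (cL / 16 * (l s / s)) \<le> ennreal (4 * (l (4 * s) / (4 * s)))"
        by (rule ennreal_leI)
      moreover have "0 \<le> l s / s" "0 \<le> l (4 * s) / (4 * s)"
        using True assms l_pos[of s] l_pos[of "4 * s"] by auto
      ultimately show ?thesis using True cL_pos
        by (simp only: ennreal_mult[symmetric] indicator_simps greaterThan_iff mult_1_right)
    qed simp
  qed
  also have "\<dots> = ennreal 4 * (\<integral>\<^sup>+s. ennreal (l (4 * s) / (4 * s)) * indicator {4 * r<..} (4 * s) \<partial>lborel)"
  proof (rule nn_integral_cmult)
    have "(\<lambda>s. ennreal (l s / s) * indicator {4 * r<..} s) \<in> borel_measurable borel"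
      using assms by (intro l_density_measurable) auto
    then show "(\<lambda>s. ennreal (l (4 * s) / (4 * s)) * indicator {4 * r<..} (4 * s)) \<in> borel_measurable lborel"
      by (intro measurable_compose[of "\<lambda>s. 4 * s" lborel borel "\<lambda>s. ennreal (l s / s) * indicator {4 * r<..} s"]) simp_all
  qed
  also have "\<dots> = (\<integral>\<^sup>+s\<in>{4 * r<..}. ennreal (l s / s) \<partial>lborel)"
    using assms by (subst nn_integral_real_affine[where c=4 and t=0 and f="\<lambda>s. ennreal (l s / s) * indicator {4 * r<..} s"])
      (simp_all add: l_density_measurable)
  also have "\<dots> = ennreal (L (4 * r))" using assms by (simp add: L_nn)
  finally have "cL / 16 * L r \<le> L (4 * r)"
    using assms L_nonneg[of "4 * r"] by simp
  moreover have "L r / a \<le> cL / 16 * L r"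
    using assms cL_pos L_pos[of r] by (simp add: field_simps)
  ultimately have "\<not> L (4 * r) < L (phi l a r)"
    using phi_props(2)[of a r] assms by linarith
  then show ?thesis
    using L_less_iff[of "4 * r" "phi l a r"] phi_props(1)[of a r] assms by simp
qed

end

subsection \<open>Symmetrization of the operator\<close>

text \<open>The first bound controls large \<open>h\<close>, the second small \<open>h\<close>;
  together they dominate the integrand of \<open>nonlocal_op\<close> by a multiple of min(1, |h|^2)
  times the kernel. The second holds because a bounded second derivative makes the gradient
  Lipschitz.\<close>

lemma Cb2_bounds:
  fixes u :: "'a::euclidean_space \<Rightarrow> real"
  assumes "u \<in> Cb2"
  obtains M where "M \<ge> 0" "\<And>x h. \<bar>u (x + h) - u x\<bar> \<le> M"
    "\<And>x h. \<bar>u (x + h) - u x - inner (grad u x) h\<bar> \<le> M * (norm h)\<^sup>2"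
proof -
  obtain G :: "'a \<Rightarrow> 'a" and H :: "'a \<Rightarrow> 'a \<Rightarrow>\<^sub>L 'a" where
    G: "\<And>x. GDERIV u x :> G x" and H: "\<And>x. (G has_derivative blinfun_apply (H x)) (at x)"
    and bH: "bounded (range H)" and bu: "bounded (range u)"
    using assms unfolding Cb2_def by blast
  obtain MH where MH: "\<And>x. norm (H x) \<le> MH" using bH by (auto simp: bounded_iff)
  obtain Mu where Mu: "\<And>x. \<bar>u x\<bar> \<le> Mu" using bu by (auto simp: bounded_iff)
  have G': "(u has_derivative (\<lambda>h. inner h (G x))) (at x)" for x
    using G by (simp add: gderiv_def)
  have grad: "grad u x = G x" for x
    unfolding grad_def
  proof (rule the_equality)
    fix D assume "GDERIV u x :> D"
    then have "(u has_derivative (\<lambda>h. inner h D)) (at x)" by (simp add: gderiv_def)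
    then have "(\<lambda>h. inner h D) = (\<lambda>h. inner h (G x))"
      using G' has_derivative_unique by blast
    then have "inner (D - G x) (D - G x) = 0" by (metis eq_iff_diff_eq_0 inner_diff_right)
    then show "D = G x" by simp
  qed (rule G)
  have lip: "norm (G y - G x) \<le> MH * norm (y - x)" for x y
  proof (rule differentiable_bound[of UNIV])
    show "(G has_derivative blinfun_apply (H x)) (at x within UNIV)" for x using H by simp
    show "onorm (blinfun_apply (H x)) \<le> MH" for x using MH[of x] by (simp add: norm_blinfun.rep_eq)
  qed auto
  have MH0: "0 \<le> MH" using MH[of 0] norm_ge_zero order_trans by blast
  show thesis
  proof (rule that[of "MH + 2 * Mu"])
    have Mu0: "0 \<le> Mu" using Mu[of 0] by linarith
    then show "0 \<le> MH + 2 * Mu" using MH0 by simp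
    show "\<bar>u (x + h) - u x\<bar> \<le> MH + 2 * Mu" for x h
      using Mu[of "x + h"] Mu[of x] MH0 by linarith
    show "\<bar>u (x + h) - u x - inner (grad u x) h\<bar> \<le> (MH + 2 * Mu) * (norm h)\<^sup>2" for x h
    proof -
      \<comment> \<open>Mean value inequality for u minus its linear part at x: on the ball of
        radius |h| the derivative of the difference has norm at most
        \<open>MH * norm h\<close>.\<close>
      have "norm ((u (x + h) - inner (x + h) (G x)) - (u x - inner x (G x))) \<le> (MH * norm h) * norm ((x + h) - x)"
      proof (rule differentiable_bound[of "cball x (norm h)"])
        fix y assume y: "y \<in> cball x (norm h)"
        show "((\<lambda>y. u y - inner y (G x)) has_derivative (\<lambda>k. inner k (G y) - inner k (G x)))
          (at y within cball x (norm h))"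
          by (intro has_derivative_diff has_derivative_at_withinI[OF G'] has_derivative_inner_left
              has_derivative_ident)
        show "onorm (\<lambda>k. inner k (G y) - inner k (G x)) \<le> MH * norm h"
        proof (rule onorm_le)
          fix k
          have "norm (inner k (G y) - inner k (G x)) \<le> norm k * norm (G y - G x)"
            by (simp add: inner_diff_right[symmetric] Cauchy_Schwarz_ineq2)
          also have "\<dots> \<le> norm k * (MH * norm h)"
          proof (rule mult_left_mono)
            have "norm (G y - G x) \<le> MH * norm (y - x)" by (rule lip)
            also have "\<dots> \<le> MH * norm h"
              using y MH0 by (intro mult_left_mono) (auto simp: dist_norm norm_minus_commute)
            finally show "norm (G y - G x) \<le> MH * norm h" .
          qed simp
          finally show "norm (inner k (G y) - inner k (G x)) \<le> MH * norm h * norm k"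
            by (simp add: mult_ac)
        qed
      qed (auto simp: dist_norm)
      then have "\<bar>u (x + h) - u x - inner (G x) h\<bar> \<le> MH * (norm h)\<^sup>2"
        by (simp add: inner_add_left inner_commute power2_eq_square algebra_simps)
      also have "\<dots> \<le> (MH + 2 * Mu) * (norm h)\<^sup>2"
        using Mu0 by (intro mult_right_mono) auto
      finally show ?thesis by (simp add: grad)
    qed
  qed
qed

lemma lborel_distr_uminus_euclidean: "distr lborel borel uminus = (lborel :: 'a::euclidean_space measure)"
  by (subst lborel_affine[of "-1" 0]) (auto simp: density_1)

lemma integral_lborel_uminus:
  fixes f :: "'a::euclidean_space \<Rightarrow> real"
  assumes "integrable lborel f"
  shows "integrable lborel (\<lambda>h. f (- h))" "(LINT h|lborel. f (- h)) = (LINT h|lborel. f h)"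
proof -
  have f: "f \<in> borel_measurable borel" using assms by simp
  have u: "(uminus :: 'a \<Rightarrow> 'a) \<in> lborel \<rightarrow>\<^sub>M borel" by simp
  show "integrable lborel (\<lambda>h. f (- h))"
    using integrable_distr_eq[OF u f] assms by (simp add: lborel_distr_uminus_euclidean)
  show "(LINT h|lborel. f (- h)) = (LINT h|lborel. f h)"
    using integral_distr[OF u f] by (simp add: lborel_distr_uminus_euclidean)
qed

lemma nn_integral_lborel_plus:
  fixes f :: "'a::euclidean_space \<Rightarrow> ennreal"
  assumes "f \<in> borel_measurable borel"
  shows "(\<integral>\<^sup>+h. f (x + h) \<partial>lborel) = (\<integral>\<^sup>+y. f y \<partial>lborel)"
proof -
  have "(\<integral>\<^sup>+y. f y \<partial>distr lborel borel ((+) x)) = (\<integral>\<^sup>+h. f (x + h) \<partial>lborel)"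
    using assms by (intro nn_integral_distr) simp_all
  then show ?thesis by (simp add: lborel_distr_plus)
qed

context radial_kernel
begin

text \<open>Nothing is assumed about \<open>K\<close> at \<open>h = 0\<close>. Extension by zero
  makes symmetry, nonnegativity and the comparison with \<open>J\<close> valid everywhere.\<close>

definition k :: "'a \<Rightarrow> 'a \<Rightarrow> real" where
  "k x h = indicator (- {0}) h * K x h"

lemma k_measurable [measurable, simp]: "k x \<in> borel_measurable borel"
proof -
  have "(\<lambda>h. (x, h)) \<in> restrict_space borel (- {0}) \<rightarrow>\<^sub>M restrict_space borel (UNIV \<times> - {0})"
    by (intro measurable_restrict_space3 borel_measurable_continuous_onI continuous_intros) auto
  from measurable_compose[OF this K_meas] have "K x \<in> borel_measurable (restrict_space borel (- {0}))"
    by simp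
  then show ?thesis
    by (subst (asm) borel_measurable_restrict_space_iff) (auto simp: k_def[abs_def])
qed

lemma k_nonneg: "0 \<le> k x h"
  using K_nonneg[of h x] by (cases "h = 0") (auto simp: k_def)

lemma k_minus: "k x (- h) = k x h"
  using K_sym[of h x] by (cases "h = 0") (auto simp: k_def)

lemma k_le: "k x h \<le> \<kappa> * J h"
  using K_upper[of h x] by (cases "h = 0") (simp_all add: k_def J_def[symmetric])

lemma k_ge: "J h \<le> \<kappa> * k x h"
  using K_lower[of h x] \<kappa>_ge by (cases "h = 0") (simp_all add: k_def J_def[symmetric] field_simps)

lemma integrable_min_k: "integrable lborel (\<lambda>h. min 1 ((norm h)\<^sup>2) * k x h)"
proof (rule integrableI_nonneg)
  have "(\<integral>\<^sup>+h. ennreal (min 1 ((norm h)\<^sup>2) * k x h) \<partial>lborel) =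
    (\<integral>\<^sup>+h\<in>-{0}. ennreal (min 1 ((norm h)\<^sup>2) * K x h) \<partial>lborel)"
    by (rule nn_integral_cong) (auto simp: k_def split: split_indicator)
  also have "\<dots> \<le> ennreal K0"
    using K_int by (simp add: SUP_le_iff)
  finally show "(\<integral>\<^sup>+h. ennreal (min 1 ((norm h)\<^sup>2) * k x h) \<partial>lborel) < \<infinity>"
    by (simp add: order_le_less_trans)
qed (auto simp: k_nonneg)

text \<open>The kernel is even in \<open>h\<close>, so the integral may be averaged over
  \<open>h\<close> and \<open>-h\<close>. The gradient term is odd, the unit ball being symmetric,
  and cancels; only symmetric second differences remain to be bounded.\<close>

lemma nonlocal_op_le:
  assumes u: "u \<in> Cb2"
    and le: "\<And>h. (u (x + h) - u x) + (u (x - h) - u x) \<le> \<Psi> h + \<Psi> (- h)"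
    and \<Psi>: "integrable lborel (\<lambda>h. \<Psi> h * k x h)"
  shows "nonlocal_op K u x \<le> (LINT h|lborel. \<Psi> h * k x h)"
proof -
  obtain M where M: "M \<ge> 0" "\<And>x h. \<bar>u (x + h) - u x\<bar> \<le> M"
    "\<And>x h. \<bar>u (x + h) - u x - inner (grad u x) h\<bar> \<le> M * (norm h)\<^sup>2"
    using Cb2_bounds[OF u] by metis
  define F where "F h = (u (x + h) - u x - inner (grad u x) h * indicator (ball 0 1) h) * k x h" for h
  have op: "nonlocal_op K u x = (LINT h|lborel. F h)"
    unfolding nonlocal_op_def set_lebesgue_integral_def F_def k_def
    by (intro Bochner_Integration.integral_cong) auto
  have cu: "continuous_on UNIV u" using u by (simp add: Cb2_def)
  then have vm: "(\<lambda>h. u (x + h)) \<in> borel_measurable borel"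
    by (intro borel_measurable_continuous_onI continuous_intros continuous_on_compose2[OF cu]) auto
  \<comment> \<open>Integrability justifies the reflection and the addition of integrals, and
    ensures that the operator is not merely the default value 0.\<close>
  have intF: "integrable lborel F"
  proof (rule Bochner_Integration.integrable_bound)
    show "integrable lborel (\<lambda>h. M * (min 1 ((norm h)\<^sup>2) * k x h))"
      using integrable_min_k by simp
    show "F \<in> borel_measurable lborel"
      unfolding F_def[abs_def]
      by (intro borel_measurable_times borel_measurable_diff borel_measurable_indicator) (simp_all add: vm)
    show "AE h in lborel. norm (F h) \<le> norm (M * (min 1 ((norm h)\<^sup>2) * k x h))"
    proof (rule AE_I2)
      fix h
      have "\<bar>u (x + h) - u x - inner (grad u x) h * indicator (ball 0 1) h\<bar> \<le> M * min 1 ((norm h)\<^sup>2)"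
      proof (cases "norm h < 1")
        case True
        then have "(norm h)\<^sup>2 \<le> 1" by (simp add: power_le_one)
        with True M(3)[of x h] show ?thesis by (simp add: min_def)
      next
        case False
        then have "(norm h)\<^sup>2 \<ge> 1" by (simp add: one_le_power)
        with False M(2)[of x h] show ?thesis by (simp add: min_def)
      qed
      then have "\<bar>u (x + h) - u x - inner (grad u x) h * indicator (ball 0 1) h\<bar> * k x h
          \<le> M * min 1 ((norm h)\<^sup>2) * k x h"
        using k_nonneg by (rule mult_right_mono)
      then show "norm (F h) \<le> norm (M * (min 1 ((norm h)\<^sup>2) * k x h))"
        using k_nonneg[of x h] M(1) by (simp add: F_def abs_mult)
    qed
  qed
  note F' = integral_lborel_uminus[OF intF] and \<Psi>' = integral_lborel_uminus[OF \<Psi>]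
  have "2 * (LINT h|lborel. F h) = (LINT h|lborel. F h + F (- h))"
    using intF F' by simp
  also have "\<dots> \<le> (LINT h|lborel. \<Psi> h * k x h + \<Psi> (- h) * k x (- h))"
  proof (rule integral_mono)
    fix h
    have "F h + F (- h) = ((u (x + h) - u x) + (u (x - h) - u x)) * k x h"
      by (simp add: F_def k_minus algebra_simps indicator_def)
    also have "\<dots> \<le> (\<Psi> h + \<Psi> (- h)) * k x h"
      using le k_nonneg by (intro mult_right_mono)
    finally show "F h + F (- h) \<le> \<Psi> h * k x h + \<Psi> (- h) * k x (- h)"
      by (simp add: k_minus algebra_simps)
  qed (use intF F' \<Psi> \<Psi>' in auto)
  also have "\<dots> = 2 * (LINT h|lborel. \<Psi> h * k x h)"
    using \<Psi> \<Psi>' by simp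
  finally show ?thesis by (simp add: op)
qed

subsection \<open>The balance at a maximum point\<close>

lemma nn_integral_bump_k:
  assumes r: "0 < r"
  shows "(\<integral>\<^sup>+h. ennreal (min 1 ((norm h)\<^sup>2 / r\<^sup>2) * k x h) \<partial>lborel)
    \<le> ennreal (\<kappa> * sphere_area TYPE('a) * Cbump * L r)"
proof -
  have "(\<integral>\<^sup>+h. ennreal (min 1 ((norm h)\<^sup>2 / r\<^sup>2) * k x h) \<partial>lborel)
    \<le> (\<integral>\<^sup>+h. ennreal \<kappa> * (ennreal (min 1 ((norm h)\<^sup>2 / r\<^sup>2)) * ennreal (J h)) \<partial>lborel)"
  proof (rule nn_integral_mono)
    fix h
    have "min 1 ((norm h)\<^sup>2 / r\<^sup>2) * k x h \<le> min 1 ((norm h)\<^sup>2 / r\<^sup>2) * (\<kappa> * J h)"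
      using k_le by (rule mult_left_mono) simp
    also have "\<dots> = \<kappa> * (min 1 ((norm h)\<^sup>2 / r\<^sup>2) * J h)" by simp
    finally have "ennreal (min 1 ((norm h)\<^sup>2 / r\<^sup>2) * k x h) \<le> ennreal (\<kappa> * (min 1 ((norm h)\<^sup>2 / r\<^sup>2) * J h))"
      by (rule ennreal_leI)
    also have "\<dots> = ennreal \<kappa> * (ennreal (min 1 ((norm h)\<^sup>2 / r\<^sup>2)) * ennreal (J h))"
      using \<kappa>_ge by (subst ennreal_mult, simp, simp, subst ennreal_mult) auto
    finally show "ennreal (min 1 ((norm h)\<^sup>2 / r\<^sup>2) * k x h)
      \<le> ennreal \<kappa> * (ennreal (min 1 ((norm h)\<^sup>2 / r\<^sup>2)) * ennreal (J h))" .
  qed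
  also have "\<dots> = ennreal \<kappa> * (\<integral>\<^sup>+h. ennreal (min 1 ((norm h)\<^sup>2 / r\<^sup>2)) * ennreal (J h) \<partial>lborel)"
    by (rule nn_integral_cmult) simp
  also have "\<dots> \<le> ennreal \<kappa> * ennreal (sphere_area TYPE('a) * Cbump * L r)"
    using nn_integral_bump[OF r] by (rule mult_left_mono) simp
  also have "\<dots> = ennreal (\<kappa> * sphere_area TYPE('a) * Cbump * L r)"
    using \<kappa>_ge Cbump_pos sphere_area_pos[where 'a='a] L_nonneg[OF r]
    by (subst ennreal_mult[symmetric]) (simp_all add: mult.assoc)
  finally show ?thesis .
qed

text \<open>For y = x + h outside \<open>ball 0 \<rho>\<close>, the bound 2|x| \<le> \<rho> \<le>
  |y| gives |y| \<le> 2|h|. So \<open>J h\<close> is at most a multiple of \<open>J y\<close>, and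
  translation reduces the integral to \<open>nn_integral_tail\<close>.\<close>

lemma nn_integral_tail_k:
  assumes \<rho>: "0 < \<rho>" and x: "2 * norm x \<le> \<rho>" and "0 < \<eta>" "\<eta> < 1" "0 \<le> C0"
  shows "(\<integral>\<^sup>+h. ennreal (C0 * (L \<rho> / L (norm (x + h))) powr \<eta> * indicator (- ball 0 \<rho>) (x + h) * k x h) \<partial>lborel)
    \<le> ennreal (\<kappa> * Cshift * sphere_area TYPE('a) * C0 * L \<rho> / (1 - \<eta>))"
proof -
  define f where "f y = ennreal (C0 * (L \<rho> / L (norm y)) powr \<eta>) * ennreal (J y) * indicator (- ball 0 \<rho>) y"
    for y
  have f: "f \<in> borel_measurable borel"
  proof -
    have "f = (\<lambda>y. ennreal (C0 * (L \<rho> / (indicator (- {0}) y * L (norm y))) powr \<eta>) * ennreal (J y)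
        * indicator (- ball 0 \<rho>) y)"
      using \<rho> by (auto simp: f_def fun_eq_iff split: split_indicator)
    also have "\<dots> \<in> borel_measurable borel"
      using L_norm_measurable by simp
    finally show ?thesis .
  qed
  have "(\<integral>\<^sup>+h. ennreal (C0 * (L \<rho> / L (norm (x + h))) powr \<eta> * indicator (- ball 0 \<rho>) (x + h) * k x h) \<partial>lborel)
    \<le> (\<integral>\<^sup>+h. ennreal (\<kappa> * Cshift) * f (x + h) \<partial>lborel)"
  proof (rule nn_integral_mono)
    fix h
    show "ennreal (C0 * (L \<rho> / L (norm (x + h))) powr \<eta> * indicator (- ball 0 \<rho>) (x + h) * k x h)
      \<le> ennreal (\<kappa> * Cshift) * f (x + h)"
    proof (cases "x + h \<in> ball 0 \<rho>")
      case False
      then have y: "\<rho> \<le> norm (x + h)" by simp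
      have "norm (x + h) \<le> norm x + norm h" by (rule norm_triangle_ineq)
      then have "norm (x + h) \<le> 3 * norm h" "h \<noteq> 0" "x + h \<noteq> 0"
        using x y \<rho> by auto
      then have "J h \<le> Cshift * J (x + h)" by (intro J_le)
      then have "k x h \<le> \<kappa> * (Cshift * J (x + h))"
        using k_le[of x h] \<kappa>_ge by (smt (verit) mult_left_mono)
      then have "C0 * (L \<rho> / L (norm (x + h))) powr \<eta> * k x h
        \<le> C0 * (L \<rho> / L (norm (x + h))) powr \<eta> * (\<kappa> * (Cshift * J (x + h)))"
        using \<open>0 \<le> C0\<close> by (intro mult_left_mono) auto
      also have "\<dots> = \<kappa> * Cshift * (C0 * (L \<rho> / L (norm (x + h))) powr \<eta> * J (x + h))"
        by (simp add: mult_ac)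
      finally have "ennreal (C0 * (L \<rho> / L (norm (x + h))) powr \<eta> * k x h)
        \<le> ennreal (\<kappa> * Cshift * (C0 * (L \<rho> / L (norm (x + h))) powr \<eta> * J (x + h)))"
        by (rule ennreal_leI)
      also have "\<dots> = ennreal (\<kappa> * Cshift) * (ennreal (C0 * (L \<rho> / L (norm (x + h))) powr \<eta>) * ennreal (J (x + h)))"
        using \<kappa>_ge Cshift_pos \<open>0 \<le> C0\<close> by (subst ennreal_mult, simp, simp, subst ennreal_mult) auto
      finally show ?thesis using False by (simp add: f_def)
    qed simp
  qed
  also have "\<dots> = ennreal (\<kappa> * Cshift) * (\<integral>\<^sup>+h. f (x + h) \<partial>lborel)"
    using f by (intro nn_integral_cmult) (auto intro!: measurable_compose[OF _ f])
  also have "(\<integral>\<^sup>+h. f (x + h) \<partial>lborel) = (\<integral>\<^sup>+y. f y \<partial>lborel)"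
    by (rule nn_integral_lborel_plus[OF f])
  also have "\<dots> = ennreal (sphere_area TYPE('a) * C0 * L \<rho> / (1 - \<eta>))"
    unfolding f_def using assms by (intro nn_integral_tail)
  also have "ennreal (\<kappa> * Cshift) * \<dots> = ennreal (\<kappa> * Cshift * sphere_area TYPE('a) * C0 * L \<rho> / (1 - \<eta>))"
    using \<kappa>_ge Cshift_pos assms sphere_area_pos[where 'a='a] L_nonneg[OF \<rho>]
    by (subst ennreal_mult[symmetric]) (simp_all add: mult.assoc)
  finally show ?thesis .
qed

text \<open>For y = x + h in \<open>E\<close>, |h| \<le> |y| + 2r \<le> 3|y|, so the kernel at
  \<open>h\<close> dominates a multiple of \<open>J y\<close>. The weight \<open>1 / L |y|\<close>
  in \<open>mu\<close> is at most \<open>1 / L \<rho>\<close> on \<open>E\<close>, which gives the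
  factor \<open>L \<rho>\<close>.\<close>

lemma nn_integral_gain_k:
  assumes r: "0 < r" and x: "norm x \<le> 2 * r" and E: "E \<in> sets borel" "E \<subseteq> ball 0 \<rho> - ball 0 r"
  shows "ennreal (L \<rho> / (\<kappa> * Cshift)) * emeasure (mu l) E
    \<le> (\<integral>\<^sup>+h. ennreal (indicator E (x + h) * k x h) \<partial>lborel)"
proof -
  define f where "f y = ennreal (J y / L (norm y)) * indicator E y" for y
  have f: "f \<in> borel_measurable borel"
    using mu_density_measurable E by (simp add: f_def[abs_def] J_def mult.commute)
  have "ennreal (L \<rho> / (\<kappa> * Cshift)) * emeasure (mu l) E = ennreal (L \<rho> / (\<kappa> * Cshift)) * (\<integral>\<^sup>+h. f (x + h) \<partial>lborel)"
    using E by (simp add: emeasure_mu nn_integral_lborel_plus[OF f]) (simp add: f_def)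
  also have "\<dots> = (\<integral>\<^sup>+h. ennreal (L \<rho> / (\<kappa> * Cshift)) * f (x + h) \<partial>lborel)"
    by (rule nn_integral_cmult[symmetric]) (auto intro!: measurable_compose[OF _ f])
  also have "\<dots> \<le> (\<integral>\<^sup>+h. ennreal (indicator E (x + h) * k x h) \<partial>lborel)"
  \<comment> \<open>The point \<open>h = 0\<close> is excluded: \<open>k x 0\<close> is 0 there,
    while \<open>f x\<close> is positive if x lies in \<open>E\<close>.\<close>
  proof (rule nn_integral_mono_AE)
    have "ennreal (L \<rho> / (\<kappa> * Cshift)) * f (x + h) \<le> ennreal (indicator E (x + h) * k x h)"
      if "h \<noteq> 0" for h
    proof (cases "x + h \<in> E")
      case True
      then have y: "r \<le> norm (x + h)" "norm (x + h) < \<rho>" using E by auto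
      have "norm h \<le> norm (x + h) + norm x" by (metis add_diff_cancel_left' norm_triangle_ineq4)
      then have "norm h \<le> 3 * norm (x + h)" "x + h \<noteq> 0" using x y r by auto
      then have "J (x + h) \<le> Cshift * J h" using that by (intro J_le)
      also have "\<dots> \<le> Cshift * (\<kappa> * k x h)" using k_ge Cshift_pos by (intro mult_left_mono) auto
      finally have J: "J (x + h) / (\<kappa> * Cshift) \<le> k x h"
        using Cshift_pos \<kappa>_ge by (simp add: field_simps)
      have L: "0 < L \<rho>" "L \<rho> \<le> L (norm (x + h))"
        using y r \<open>x + h \<noteq> 0\<close> L_pos[of \<rho>] L_antimono[of "norm (x + h)" \<rho>] by auto
      have "L \<rho> / (\<kappa> * Cshift) * (J (x + h) / L (norm (x + h)))
        = (L \<rho> / L (norm (x + h))) * (J (x + h) / (\<kappa> * Cshift))"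
        by simp
      also have "\<dots> \<le> 1 * (J (x + h) / (\<kappa> * Cshift))"
        using L Cshift_pos \<kappa>_ge by (intro mult_right_mono) (auto simp: divide_le_eq_1)
      finally have "ennreal (L \<rho> / (\<kappa> * Cshift) * (J (x + h) / L (norm (x + h)))) \<le> ennreal (k x h)"
        using J by (intro ennreal_leI) simp
      moreover have "ennreal (L \<rho> / (\<kappa> * Cshift) * (J (x + h) / L (norm (x + h)))) =
        ennreal (L \<rho> / (\<kappa> * Cshift)) * ennreal (J (x + h) / L (norm (x + h)))"
        using L Cshift_pos \<kappa>_ge by (intro ennreal_mult) auto
      ultimately show ?thesis using True by (simp add: f_def)
    qed (simp add: f_def)
    then show "AE h in lborel. ennreal (L \<rho> / (\<kappa> * Cshift)) * f (x + h) \<le> ennreal (indicator E (x + h) * k x h)"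
      using AE_lborel_singleton[of 0] by (rule eventually_mono[rotated])
  qed
  finally show ?thesis .
qed

text \<open>The consequence of a value above \<open>1 - \<theta>\<close> in the small ball, for any
  radius \<rho> at least 4r. The gain on the left carries the logarithm of
  \<open>L r / L \<rho>\<close>; on the right stand the lower bound on the operator, the cost of the
  quadratic and that of the exterior growth.\<close>

lemma growth_balance:
  assumes r: "0 < r" and \<rho>: "4 * r \<le> \<rho>" and v: "v \<in> Cb2" and \<theta>: "0 < \<theta>" "\<theta> \<le> 1 / 10"
    and \<eta>: "0 < \<eta>" "\<eta> < 1" and C0: "0 \<le> C0" and \<delta>: "0 \<le> \<delta>"
    and Av: "\<And>x. x \<in> ball 0 \<rho> \<Longrightarrow> - nonlocal_op K v x \<le> L \<rho>"
    and v1: "\<And>x. x \<in> ball 0 \<rho> \<Longrightarrow> v x \<le> 1"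
    and vtail: "\<And>x. x \<in> - ball 0 \<rho> \<Longrightarrow> v x \<le> C0 * (L \<rho> / L (norm x)) powr \<eta>"
    and vmu: "emeasure (mu l) ((ball 0 \<rho> - ball 0 r) \<inter> {x. v x \<le> 0})
        \<ge> ennreal \<delta> * emeasure (mu l) (ball 0 \<rho> - ball (0::'a) r)"
    and x0: "x0 \<in> ball 0 r" "v x0 > 1 - \<theta>"
  shows "L \<rho> / (\<kappa> * Cshift) * (\<delta> * (sphere_area TYPE('a) * ln (L r / L \<rho>))) / 4
    \<le> L \<rho> + 2 * \<theta> * (\<kappa> * sphere_area TYPE('a) * Cbump * L r)
      + \<kappa> * Cshift * sphere_area TYPE('a) * C0 * L \<rho> / (1 - \<eta>)"
proof -
  \<comment> \<open>The coefficients make \<open>b\<close> at least 1 on \<open>ball 0 r\<close> and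
    at most 0 from radius 2r on. Hence w exceeds 1 at \<open>x0\<close>, and its maximum over the
    closed ball of radius 2r is also one over \<open>ball 0 \<rho>\<close>.\<close>
  define b :: "'a \<Rightarrow> real" where "b x = 2 - (norm x)\<^sup>2 / (2 * r\<^sup>2)" for x
  define w where "w x = v x + \<theta> * b x" for x
  have cv: "continuous_on UNIV v" using v by (simp add: Cb2_def)
  have "continuous_on (cball 0 (2 * r)) w"
    unfolding w_def b_def by (intro continuous_intros continuous_on_subset[OF cv]) (use r in auto)
  then obtain x where x: "x \<in> cball 0 (2 * r)" and wmax: "\<And>y. y \<in> cball 0 (2 * r) \<Longrightarrow> w y \<le> w x"
    using continuous_attains_sup[of "cball 0 (2 * r)" w] r by auto
  have xr: "norm x \<le> 2 * r" using x by simp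
  have bx: "b x \<le> 2" by (simp add: b_def)
  have "(norm x0)\<^sup>2 \<le> r\<^sup>2" using x0 r by (intro power_mono) auto
  then have "(norm x0)\<^sup>2 \<le> 2 * r\<^sup>2" using zero_le_power2[of r] by linarith
  then have "b x0 \<ge> 1" using r by (simp add: b_def field_simps)
  then have "\<theta> * 1 \<le> \<theta> * b x0" using \<theta> by (intro mult_left_mono) auto
  then have "w x0 > 1" using x0 by (simp add: w_def)
  moreover have "w x0 \<le> w x" using x0 r by (intro wmax) auto
  ultimately have wx: "w x > 1" by simp
  have \<theta>b: "\<theta> * b x \<le> 2 * \<theta>" using bx \<theta> by simp
  have vx: "v x > 1 - 2 * \<theta>" using wx \<theta>b by (simp add: w_def)
  have wmax': "w y \<le> w x" if "y \<in> ball 0 \<rho>" for y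
  proof (cases "norm y \<le> 2 * r")
    case False
    then have "(2 * r)\<^sup>2 \<le> (norm y)\<^sup>2" using r by (intro power_mono) auto
    then have "b y \<le> 0" using r by (simp add: b_def field_simps power_mult_distrib)
    then have "\<theta> * b y \<le> 0" using \<theta> by (simp add: mult_nonneg_nonpos)
    then show ?thesis using v1[OF that] wx by (simp add: w_def)
  qed (use wmax in simp)

  \<comment> \<open>A majorant for the increments of v at the maximum point\<close>
  define E where "E = (ball 0 \<rho> - ball 0 r) \<inter> {x. v x \<le> 0}"
  have E_sets: "E \<in> sets borel"
  proof -
    have "closed {x. v x \<le> 0}"
      using cv by (intro closed_Collect_le) (auto intro: continuous_intros)
    then show ?thesis unfolding E_def by (intro sets.Int sets.Diff borel_closed borel_open) auto
  qed
  define q where "q h = min 1 ((norm h)\<^sup>2 / r\<^sup>2)" for h :: 'a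
  define T where "T h = C0 * (L \<rho> / L (norm (x + h))) powr \<eta> * indicator (- ball 0 \<rho>) (x + h)" for h
  define e where "e h = (indicator E (x + h) :: real)" for h
  \<comment> \<open>The weight 1/4 and the bound \<theta> \<le> 1/10 come from the case |h| < r: if
    x + h or x - h lies in \<open>E\<close>, the second difference is at most
    \<open>9 / 2 * \<theta> - 1\<close>, which is below -1/2 and pays for 1/4 at both
    points.\<close>
  define \<Psi> where "\<Psi> h = 2 * \<theta> * q h + T h - e h / 4" for h
  have q0: "0 \<le> q h" for h by (simp add: q_def)
  have T0: "0 \<le> T h" for h using C0 by (simp add: T_def)
  have e0: "0 \<le> e h" "e h \<le> 1" for h by (simp_all add: e_def indicator_le_1)

  \<comment> \<open>For |h| \<ge> r no cancellation is required: \<open>q h = 1\<close>, and inside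
    \<open>ball 0 \<rho>\<close> v rises by less than 2\<theta> because v \<le> 1 there and v x > 1
    - 2\<theta>.\<close>
  have far: "v (x + h) - v x \<le> \<Psi> h" if "r \<le> norm h" for h
  proof -
    have q: "q h = 1"
    proof -
      have "r\<^sup>2 \<le> (norm h)\<^sup>2" using that r by (intro power_mono) auto
      then show ?thesis using r by (simp add: q_def)
    qed
    show ?thesis
    proof (cases "x + h \<in> ball 0 \<rho>")
      case True
      then have T: "T h = 0" by (simp add: T_def)
      show ?thesis
      proof (cases "x + h \<in> E")
        case True
        then have "v (x + h) \<le> 0" "e h = 1" by (auto simp: E_def e_def)
        then show ?thesis using vx \<theta> by (simp add: \<Psi>_def q T)
      next
        case False
        then have "e h = 0" by (simp add: e_def)
        then show ?thesis using v1[OF True] wx \<theta>b by (simp add: \<Psi>_def q T w_def)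
      qed
    next
      case False
      then have "e h = 0" "v (x + h) \<le> T h" using vtail[of "x + h"] by (auto simp: E_def e_def T_def)
      then show ?thesis using vx \<theta> by (simp add: \<Psi>_def q)
    qed
  qed
  \<comment> \<open>Here x + h has norm below 3r, so maximality of w bounds the increment of v by
    \<theta> times the decrement of \<open>b\<close>. Its part linear in \<open>h\<close> is odd and
    disappears on adding the estimate for \<open>-h\<close>.\<close>
  have near: "v (x + h) - v x \<le> \<theta> * (2 * inner x h + (norm h)\<^sup>2) / (2 * r\<^sup>2)" if "norm h < r" for h
  proof -
    have "norm (x + h) < \<rho>" using norm_triangle_ineq[of x h] that xr \<rho> r by linarith
    then have "w (x + h) \<le> w x" by (intro wmax') simp
    then have "v (x + h) - v x \<le> \<theta> * (b x - b (x + h))" by (simp add: w_def algebra_simps)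
    also have "b x - b (x + h) = (2 * inner x h + (norm h)\<^sup>2) / (2 * r\<^sup>2)"
      using r unfolding b_def power2_norm_eq_inner
      by (simp add: inner_add_left inner_add_right inner_commute field_simps)
    finally show ?thesis by simp
  qed
  have pointwise: "(v (x + h) - v x) + (v (x - h) - v x) \<le> \<Psi> h + \<Psi> (- h)" for h
  proof (cases "norm h < r")
    case False
    then show ?thesis using far[of h] far[of "- h"] by simp
  next
    case True
    have qh: "q h = (norm h)\<^sup>2 / r\<^sup>2" "q (- h) = (norm h)\<^sup>2 / r\<^sup>2"
      using True r by (simp_all add: q_def min_def divide_le_eq_1 power_mono)
    have "(v (x + h) - v x) + (v (x - h) - v x) \<le>
      \<theta> * (2 * inner x h + (norm h)\<^sup>2) / (2 * r\<^sup>2) + \<theta> * (2 * inner x (- h) + (norm (- h))\<^sup>2) / (2 * r\<^sup>2)"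
      using near[of h] near[of "- h"] True by simp
    also have "\<dots> = \<theta> * q h" using r by (simp add: qh field_simps)
    finally have both: "(v (x + h) - v x) + (v (x - h) - v x) \<le> \<theta> * q h" .
    \<comment> \<open>If only one of x + h and x - h lies in \<open>E\<close>, the rise at the other
      must be bounded separately. The constant is (2 * 2 + 1) / 2, from |x| \<le> 2r and |h| <
      r.\<close>
    have one: "(v (x + h') - v x) \<le> 5 / 2 * \<theta>" if "norm h' = norm h" for h'
    proof -
      have "inner x h' \<le> norm x * norm h'" by (rule norm_cauchy_schwarz)
      also have "\<dots> \<le> (2 * r) * r" using xr True that r by (intro mult_mono) auto
      finally have "inner x h' \<le> 2 * r\<^sup>2" by (simp add: power2_eq_square)
      moreover have "(norm h')\<^sup>2 \<le> r\<^sup>2" using True that by (intro power_mono) auto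
      ultimately have le: "2 * inner x h' + (norm h')\<^sup>2 \<le> 5 * r\<^sup>2" by linarith
      have "v (x + h') - v x \<le> \<theta> * (2 * inner x h' + (norm h')\<^sup>2) / (2 * r\<^sup>2)"
        using True that by (intro near) simp
      also have "\<dots> \<le> \<theta> * (5 * r\<^sup>2) / (2 * r\<^sup>2)"
        using \<theta> le by (intro divide_right_mono mult_left_mono) auto
      also have "\<dots> = 5 / 2 * \<theta>" using r by simp
      finally show ?thesis .
    qed
    have neg: "v (x + h') - v x \<le> 2 * \<theta> - 1" if "x + h' \<in> E" for h'
      using that vx by (simp add: E_def)
    have "0 \<le> \<theta> * q h" using \<theta> q0 by simp
    have "(v (x + h) - v x) + (v (x - h) - v x) \<le> \<theta> * q h - e h / 4 - e (- h) / 4"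
    proof (cases "x + h \<in> E \<or> x - h \<in> E")
      case True
      then have "(v (x + h) - v x) + (v (x - h) - v x) \<le> 9 / 2 * \<theta> - 1"
        using neg[of h] neg[of "- h"] one[of h] one[of "- h"] by auto
      then show ?thesis using \<theta> e0(2)[of h] e0(2)[of "- h"] \<open>0 \<le> \<theta> * q h\<close> by linarith
    qed (use both in \<open>simp add: e_def\<close>)
    then show ?thesis
      using T0[of h] T0[of "- h"] \<open>0 \<le> \<theta> * q h\<close> by (simp add: \<Psi>_def qh)
  qed

  \<comment> \<open>Integrals of the three pieces of the majorant\<close>
  have q_int: "integrable lborel (\<lambda>h. q h * k x h)"
    and q_le: "(LINT h|lborel. q h * k x h) \<le> \<kappa> * sphere_area TYPE('a) * Cbump * L r"
  proof -
    have le: "(\<integral>\<^sup>+h. ennreal (q h * k x h) \<partial>lborel) \<le> ennreal (\<kappa> * sphere_area TYPE('a) * Cbump * L r)"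
      unfolding q_def by (rule nn_integral_bump_k[OF r])
    show i: "integrable lborel (\<lambda>h. q h * k x h)"
    proof (rule integrableI_nonneg)
      show "(\<integral>\<^sup>+h. ennreal (q h * k x h) \<partial>lborel) < \<infinity>"
        using le by (simp add: order_le_less_trans)
    qed (auto simp: k_nonneg q_def)
    have "0 \<le> \<kappa> * sphere_area TYPE('a) * Cbump * L r"
      using \<kappa>_ge Cbump_pos sphere_area_pos[where 'a='a] L_nonneg[OF r] by simp
    then show "(LINT h|lborel. q h * k x h) \<le> \<kappa> * sphere_area TYPE('a) * Cbump * L r"
      using le nn_integral_eq_integral[OF i] q0 k_nonneg by simp
  qed
  have T_int: "integrable lborel (\<lambda>h. T h * k x h)"
    and T_le: "(LINT h|lborel. T h * k x h) \<le> \<kappa> * Cshift * sphere_area TYPE('a) * C0 * L \<rho> / (1 - \<eta>)"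
  proof -
    have \<rho>0: "0 < \<rho>" using \<rho> r by simp
    have le: "(\<integral>\<^sup>+h. ennreal (T h * k x h) \<partial>lborel) \<le> ennreal (\<kappa> * Cshift * sphere_area TYPE('a) * C0 * L \<rho> / (1 - \<eta>))"
      unfolding T_def using \<rho>0 xr \<rho> \<eta> C0 by (intro nn_integral_tail_k) auto
    have Tm: "T \<in> borel_measurable borel"
    proof -
      define f where "f y = C0 * (L \<rho> / (indicator (- {0}) y * L (norm y))) powr \<eta> * indicator (- ball 0 \<rho>) y" for y :: 'a
      have f: "f \<in> borel_measurable borel" unfolding f_def using L_norm_measurable by simp
      have "T = (\<lambda>h. f (x + h))"
        using \<rho>0 by (auto simp: T_def f_def fun_eq_iff split: split_indicator)
      then show ?thesis using measurable_compose[OF _ f, of "\<lambda>h. x + h" borel] by simp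
    qed
    show i: "integrable lborel (\<lambda>h. T h * k x h)"
    proof (rule integrableI_nonneg)
      show "(\<integral>\<^sup>+h. ennreal (T h * k x h) \<partial>lborel) < \<infinity>"
        using le by (simp add: order_le_less_trans)
    qed (use Tm k_nonneg T0 in auto)
    have "0 \<le> \<kappa> * Cshift * sphere_area TYPE('a) * C0 * L \<rho> / (1 - \<eta>)"
      using \<kappa>_ge Cshift_pos sphere_area_pos[where 'a='a] L_nonneg[OF \<rho>0] C0 \<eta> by simp
    then show "(LINT h|lborel. T h * k x h) \<le> \<kappa> * Cshift * sphere_area TYPE('a) * C0 * L \<rho> / (1 - \<eta>)"
      using le nn_integral_eq_integral[OF i] T0 k_nonneg by simp
  qed
  have e_int: "integrable lborel (\<lambda>h. e h * k x h)"
    and e_ge: "L \<rho> / (\<kappa> * Cshift) * (\<delta> * (sphere_area TYPE('a) * ln (L r / L \<rho>))) \<le> (LINT h|lborel. e h * k x h)"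
  proof -
    have em: "e \<in> borel_measurable borel"
      unfolding e_def using E_sets
      by (intro measurable_compose[OF _ borel_measurable_indicator, of "\<lambda>h. x + h" borel]) simp_all
    \<comment> \<open>Since v x > 0 and v is continuous, \<open>E\<close> keeps a distance
      \<epsilon> from x. Thus \<open>e\<close> vanishes for |h| < \<epsilon>, away from the
      singularity of the kernel, and is dominated by \<open>c\<close> times min(1, |h|^2).\<close>
    have vx0: "v x > 0" using vx \<theta> by simp
    have "isCont v x" using cv by (simp add: continuous_on_eq_continuous_at)
    then obtain \<epsilon> where \<epsilon>: "\<epsilon> > 0" and "\<And>y. dist y x < \<epsilon> \<Longrightarrow> dist (v y) (v x) < v x"
      using vx0 unfolding continuous_at_eps_delta by blast
    then have pos: "v y > 0" if "dist y x < \<epsilon>" for y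
      using that by (force simp: dist_real_def)
    define c where "c = 1 / min 1 (\<epsilon>\<^sup>2)"
    have c: "c > 0" using \<epsilon> by (simp add: c_def)
    show i: "integrable lborel (\<lambda>h. e h * k x h)"
    proof (rule Bochner_Integration.integrable_bound)
      show "integrable lborel (\<lambda>h. c * (min 1 ((norm h)\<^sup>2) * k x h))"
        using integrable_min_k by simp
      show "AE h in lborel. norm (e h * k x h) \<le> norm (c * (min 1 ((norm h)\<^sup>2) * k x h))"
      proof (rule AE_I2)
        fix h
        have "e h \<le> c * min 1 ((norm h)\<^sup>2)"
        proof (cases "x + h \<in> E")
          case True
          then have "\<epsilon> \<le> norm h"
            using pos[of "x + h"] by (force simp: E_def dist_norm)
          then have "\<epsilon>\<^sup>2 \<le> (norm h)\<^sup>2" using \<epsilon> by (intro power_mono) auto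
          then have "min 1 (\<epsilon>\<^sup>2) \<le> min 1 ((norm h)\<^sup>2)" by simp
          moreover have "0 < min 1 (\<epsilon>\<^sup>2)" using \<epsilon> by simp
          ultimately show ?thesis using True by (simp add: e_def c_def)
        qed (use c in \<open>simp add: e_def\<close>)
        then have "e h * k x h \<le> c * min 1 ((norm h)\<^sup>2) * k x h"
          using k_nonneg by (rule mult_right_mono)
        then show "norm (e h * k x h) \<le> norm (c * (min 1 ((norm h)\<^sup>2) * k x h))"
          using k_nonneg[of x h] e0[of h] c by (simp add: abs_mult)
      qed
    qed (use em in simp)
    have L: "0 < L \<rho>" "L \<rho> \<le> L r" using r \<rho> L_pos L_antimono by auto
    have "ennreal (L \<rho> / (\<kappa> * Cshift)) * (ennreal \<delta> * ennreal (sphere_area TYPE('a) * ln (L r / L \<rho>)))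
      \<le> ennreal (L \<rho> / (\<kappa> * Cshift)) * emeasure (mu l) E"
      using vmu mu_annulus[of r \<rho>] r \<rho> by (intro mult_left_mono) (simp_all add: E_def)
    also have "\<dots> \<le> (\<integral>\<^sup>+h. ennreal (e h * k x h) \<partial>lborel)"
      unfolding e_def using r xr E_sets by (intro nn_integral_gain_k) (auto simp: E_def)
    also have "\<dots> = ennreal (LINT h|lborel. e h * k x h)"
      using nn_integral_eq_integral[OF i] e0 k_nonneg by simp
    finally have "ennreal (L \<rho> / (\<kappa> * Cshift)) * (ennreal \<delta> * ennreal (sphere_area TYPE('a) * ln (L r / L \<rho>)))
      \<le> ennreal (LINT h|lborel. e h * k x h)" .
    moreover have "ennreal (L \<rho> / (\<kappa> * Cshift)) * (ennreal \<delta> * ennreal (sphere_area TYPE('a) * ln (L r / L \<rho>)))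
      = ennreal (L \<rho> / (\<kappa> * Cshift) * (\<delta> * (sphere_area TYPE('a) * ln (L r / L \<rho>))))"
    proof -
      have "0 \<le> L \<rho> / (\<kappa> * Cshift)" using L \<kappa>_ge Cshift_pos by simp
      moreover have "0 \<le> sphere_area TYPE('a) * ln (L r / L \<rho>)"
        using L sphere_area_pos[where 'a='a] by simp
      ultimately show ?thesis using \<delta> by (simp only: ennreal_mult mult_nonneg_nonneg)
    qed
    moreover have "0 \<le> (LINT h|lborel. e h * k x h)"
      by (rule Bochner_Integration.integral_nonneg) (simp add: e0 k_nonneg)
    ultimately show "L \<rho> / (\<kappa> * Cshift) * (\<delta> * (sphere_area TYPE('a) * ln (L r / L \<rho>))) \<le> (LINT h|lborel. e h * k x h)"
      by (simp only: ennreal_le_iff)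
  qed

  \<comment> \<open>Combination with the lower bound on the operator\<close>
  have \<Psi>k: "\<Psi> h * k x h = 2 * \<theta> * (q h * k x h) + T h * k x h - e h * k x h / 4" for h
    by (simp add: \<Psi>_def algebra_simps)
  have "nonlocal_op K v x \<le> (LINT h|lborel. \<Psi> h * k x h)"
    using q_int T_int e_int by (intro nonlocal_op_le[OF v pointwise]) (simp add: \<Psi>k)
  also have "\<dots> = 2 * \<theta> * (LINT h|lborel. q h * k x h) + (LINT h|lborel. T h * k x h)
      - (LINT h|lborel. e h * k x h) / 4"
    using q_int T_int e_int by (simp add: \<Psi>k)
  finally have op: "nonlocal_op K v x \<le> \<dots>" .
  have low: "- nonlocal_op K v x \<le> L \<rho>" using xr \<rho> r by (intro Av) simp
  have bump: "2 * \<theta> * (LINT h|lborel. q h * k x h) \<le> 2 * \<theta> * (\<kappa> * sphere_area TYPE('a) * Cbump * L r)"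
    using q_le \<theta> by (intro mult_left_mono) auto
  have "G / 4 \<le> S + Q' + T'" if "N \<le> Q + T - e / 4" "- N \<le> S" "Q \<le> Q'" "T \<le> T'" "G \<le> e"
    for G S Q Q' T T' N e :: real
    using that by linarith
  from this[OF op low bump T_le e_ge] show ?thesis .
qed

text \<open>As \<open>L r = a * L \<rho>\<close>, division of the balance by \<open>L \<rho>\<close>
  leaves \<open>Y * ln a \<le> 1 + 2 * \<theta> * Z * a + X\<close>, free of r and v. Suitable
  \<open>a\<close> and \<theta>, chosen from X, Y, Z and cL alone, violate it.\<close>

lemma growth_constants:
  assumes \<eta>: "0 < \<eta>" "\<eta> < 1" and C0: "0 < C0" and \<delta>: "0 < \<delta>"
  shows "\<exists>a \<theta>. a > 2 \<and> 0 < \<theta> \<and> \<theta> < 1 \<and>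
    (\<forall>r > 0. \<forall>v \<in> Cb2.
      (\<forall>x \<in> ball 0 (phi l a r). - nonlocal_op K v x \<le> L (phi l a r)) \<and>
      (\<forall>x \<in> ball 0 (phi l a r). v x \<le> 1) \<and>
      (\<forall>x \<in> - ball 0 (phi l a r).
         v x \<le> C0 * (L (phi l a r) / L (norm x)) powr \<eta>) \<and>
      emeasure (mu l) ((ball 0 (phi l a r) - ball 0 r) \<inter> {x. v x \<le> 0})
        \<ge> ennreal \<delta> * emeasure (mu l) (ball 0 (phi l a r) - ball (0::'a) r)
      \<longrightarrow> (\<forall>x \<in> ball 0 r. v x \<le> 1 - \<theta>))"
proof -
  define X where "X = \<kappa> * Cshift * sphere_area TYPE('a) * C0 / (1 - \<eta>)"
  define Y where "Y = \<delta> * sphere_area TYPE('a) / (4 * \<kappa> * Cshift)"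
  define Z where "Z = \<kappa> * sphere_area TYPE('a) * Cbump"
  note pos = sphere_area_pos[where 'a='a] Cshift_pos Cbump_pos \<kappa>_ge
  have Y: "Y > 0" using pos \<delta> by (simp add: Y_def)
  have Z: "Z > 0" using pos by (simp add: Z_def)
  \<comment> \<open>The 3 ensures a > 2, \<open>16 / cL\<close> is the requirement of
    \<open>phi_ge\<close>, and the exponential gives \<open>Y * ln a \<ge> X + 3\<close>.\<close>
  define a where "a = max (max 3 (16 / cL)) (exp ((X + 3) / Y))"
  have a: "a > 2" "a \<ge> 16 / cL" "a \<ge> exp ((X + 3) / Y)" by (auto simp: a_def)
  \<comment> \<open>With a fixed, the second entry makes \<open>2 * \<theta> * Z * a\<close> at most
    1, so the right side of the balance is at most X + 2; the first is the smallness demanded by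
    \<open>growth_balance\<close>.\<close>
  define \<theta> where "\<theta> = min (1 / 10) (1 / (2 * Z * a))"
  have \<theta>: "0 < \<theta>" "\<theta> \<le> 1 / 10" "\<theta> \<le> 1 / (2 * Z * a)" using Z a by (auto simp: \<theta>_def)
  have ln_a: "Y * ln a \<ge> X + 3"
  proof -
    have "(X + 3) / Y \<le> ln a" using a by (simp add: ln_ge_iff)
    then show ?thesis using Y by (simp add: field_simps)
  qed
  have \<theta>Za: "2 * \<theta> * Z * a \<le> 1" using \<theta>(3) Z a by (simp add: field_simps)
  show ?thesis
  proof (rule exI[of _ a], rule exI[of _ \<theta>], intro conjI allI impI ballI)
    fix r v x0
    define \<rho> where "\<rho> = phi l a r"
    assume r: "0 < r" and v: "v \<in> Cb2" and x0: "x0 \<in> ball (0::'a) r"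
      and H: "(\<forall>x \<in> ball 0 (phi l a r). - nonlocal_op K v x \<le> L (phi l a r)) \<and>
      (\<forall>x \<in> ball 0 (phi l a r). v x \<le> 1) \<and>
      (\<forall>x \<in> - ball 0 (phi l a r).
         v x \<le> C0 * (L (phi l a r) / L (norm x)) powr \<eta>) \<and>
      emeasure (mu l) ((ball 0 (phi l a r) - ball 0 r) \<inter> {x. v x \<le> 0})
        \<ge> ennreal \<delta> * emeasure (mu l) (ball 0 (phi l a r) - ball (0::'a) r)"
    have \<rho>: "4 * r \<le> \<rho>" "L \<rho> = L r / a"
      unfolding \<rho>_def using a r phi_ge[of r a] phi_props(2)[of a r] by auto
    then have L: "L r = a * L \<rho>" "0 < L \<rho>" using a L_pos[of \<rho>] r by auto
    show "v x0 \<le> 1 - \<theta>"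
    proof (rule ccontr)
      assume "\<not> ?thesis"
      then have "L \<rho> / (\<kappa> * Cshift) * (\<delta> * (sphere_area TYPE('a) * ln (L r / L \<rho>))) / 4
        \<le> L \<rho> + 2 * \<theta> * (\<kappa> * sphere_area TYPE('a) * Cbump * L r)
          + \<kappa> * Cshift * sphere_area TYPE('a) * C0 * L \<rho> / (1 - \<eta>)"
        using H \<rho> \<theta> \<eta> C0 \<delta> x0 unfolding \<rho>_def[symmetric]
        by (intro growth_balance[OF r \<rho>(1) v]) auto
      also have "L \<rho> / (\<kappa> * Cshift) * (\<delta> * (sphere_area TYPE('a) * ln (L r / L \<rho>))) / 4 = L \<rho> * (Y * ln a)"
        using L by (simp add: Y_def mult_ac)
      also have "L \<rho> + 2 * \<theta> * (\<kappa> * sphere_area TYPE('a) * Cbump * L r)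
          + \<kappa> * Cshift * sphere_area TYPE('a) * C0 * L \<rho> / (1 - \<eta>) = L \<rho> * (1 + 2 * \<theta> * Z * a + X)"
        by (simp add: L X_def Z_def algebra_simps)
      finally have "Y * ln a \<le> 1 + 2 * \<theta> * Z * a + X" using L by simp
      with ln_a \<theta>Za show False by linarith
    qed
  qed (use a \<theta> in auto)
qed

end

theorem lemma2:
  fixes l :: "real \<Rightarrow> real"
    and K :: "'a::euclidean_space \<Rightarrow> 'a \<Rightarrow> real"
    and \<kappa> K0 cL cU \<gamma> \<eta> \<delta> C0 :: real
  assumes "\<kappa> \<ge> 1" and "K0 \<ge> 1" and "0 < cL" and "cL < 1" and "cU \<ge> 1"
    and "0 < \<gamma>" and "\<gamma> < 2"
    and l_meas: "l \<in> borel_measurable (restrict_space borel {0<..})"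
    and l_pos: "\<And>s. s > 0 \<Longrightarrow> l s > 0"
    and l_int_0: "(\<integral>\<^sup>+s\<in>{0<..}. ennreal (l s / s) \<partial>lborel) = \<infinity>"
    and l_int: "\<And>r. r > 0 \<Longrightarrow> (\<integral>\<^sup>+s\<in>{r<..}. ennreal (l s / s) \<partial>lborel) < \<infinity>"
    and l_lower: "\<And>r t. r > 0 \<Longrightarrow> t \<ge> 1 \<Longrightarrow> l (r * t) / l r \<ge> cL * t powr (- \<gamma>)"
    and l_upper: "\<And>r t. r > 0 \<Longrightarrow> t \<ge> 1 \<Longrightarrow> l (r * t) / l r \<le> cU * t ^ DIM('a)"
    and K_meas: "(\<lambda>(x, h). K x h) \<in> borel_measurable (restrict_space borel (UNIV \<times> - {0}))"
    and K_nonneg: "\<And>x h. h \<noteq> 0 \<Longrightarrow> K x h \<ge> 0"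
    and K_sym: "\<And>x h. h \<noteq> 0 \<Longrightarrow> K x h = K x (- h)"
    and K_lower: "\<And>x h. h \<noteq> 0 \<Longrightarrow> inverse \<kappa> * (l (norm h) / norm h ^ DIM('a)) \<le> K x h"
    and K_upper: "\<And>x h. h \<noteq> 0 \<Longrightarrow> K x h \<le> \<kappa> * (l (norm h) / norm h ^ DIM('a))"
    and K_int: "(SUP x. \<integral>\<^sup>+h\<in>-{0}. ennreal (min 1 ((norm h)\<^sup>2) * K x h) \<partial>lborel) \<le> ennreal K0"
    and "0 < \<eta>" and "\<eta> < 1" and "0 < \<delta>" and "\<delta> < 1" and "C0 > 0"
  shows "\<exists>a \<theta>. a > 2 \<and> 0 < \<theta> \<and> \<theta> < 1 \<and>
    (\<forall>r > 0. \<forall>v \<in> Cb2.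
      (\<forall>x \<in> ball 0 (phi l a r). - nonlocal_op K v x \<le> L_fun l (phi l a r)) \<and>
      (\<forall>x \<in> ball 0 (phi l a r). v x \<le> 1) \<and>
      (\<forall>x \<in> - ball 0 (phi l a r).
         v x \<le> C0 * (L_fun l (phi l a r) / L_fun l (norm x)) powr \<eta>) \<and>
      emeasure (mu l) ((ball 0 (phi l a r) - ball 0 r) \<inter> {x. v x \<le> 0})
        \<ge> ennreal \<delta> * emeasure (mu l) (ball 0 (phi l a r) - ball (0::'a) r)
      \<longrightarrow> (\<forall>x \<in> ball 0 r. v x \<le> 1 - \<theta>))"
proof -
  interpret radial_kernel l cL cU \<gamma> K \<kappa> K0
    using assms by unfold_locales
  show ?thesis
    using assms by (intro growth_constants)
qed

end
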